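(* Let $d\ge1$ and let $\sigma:\mathbb{R}^d\to\mathbb{R}_+$ be a random density, with associated pseudometric $T$, such that: almost surely $\sigma$ is measurable; for every $x\in\mathbb{R}^d$, $\mathbb{E}\int_{[0,x]}\sigma<+\infty$; the translations of $\mathbb{R}^d$ are ergodic for the law of $\sigma$; and there exists $C>0$ such that $T$ is $C$-Lipschitz for the Euclidean metric. Let $\mu(v)=\lim_{n\to\infty}\frac1nT(0,nv)$ (almost sure and $L^1$ limit), $B_t=\{x\in\mathbb{R}^d:T(0,x)\le t\}$ for $t\ge 0$, $K=\{x\in\mathbb{R}^d:\mu(x)\le1\}$, and let $\mathbb{B}$ be the unit Euclidean ball. 1. If $\mu=0$, then for every $M>0$, $$\mathbb{P}\Big[M\mathbb{B}\subset\tfrac1tB_t\text{ for all $t$ large enough}\Big]=1.$$ 2. If $\mu$ is a norm, then $K$ is a convex compact subset of $\mathbb{R}^d$ with non-empty interior, and for every $\epsilon>0$, $$\mathbb{P}\Big[(1-\epsilon)K\subset\tfrac1tB_t\subset(1+\epsilon)K\text{ for all $t$ large enough}\Big]=1.$$ If moreover the law of $\sigma$ is invariant under the orthogonal group of $\mathbb{R}^d$, then $K=\frac1{\mu(1)}\mathbb{B}$, where $\mu(1)$ is the common value of $\mu$ on unit vectors.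
   Context: A random density is a random function $\sigma:\mathbb{R}^d\to\mathbb{R}_+$. Its associated pseudometric is $T(x,y)=\inf_\gamma\int_\gamma\sigma$, the infimum being over piecewise $C^1$ paths from $x$ to $y$, with integral with respect to Euclidean arc length; $[0,x]$ denotes the segment from $0$ to $x$. Translations act on densities by $\tau_v(\sigma)=\sigma\circ\tau_v$, $\tau_v(x)=x+v$. The action $\tau_v$ is ergodic for the law of $\sigma$ if the law is $\tau_v$-invariant and every $\tau_v$-invariant event has probability $0$ or $1$; the translations are ergodic if this holds for every $v\neq0$. Under the stated hypotheses the limit $\mu$ exists and is deterministic.
   Formalization: In item 2 the inclusion (1-ε)K ⊂ B_t/t is claimed only for 0<ε≤1, since for ε>2 it is false as written (σ=1, ε=3: (1-ε)K is the ball of radius 2, while B_t/t is the unit ball); the inclusion B_t/t ⊂ (1+ε)K is kept for every ε>0. *)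

theory Defs
  imports "HOL-Probability.Probability"
begin

text \<open>
  Deterministic densities. The integral is the \<open>[0, \<infinity>]\<close>-valued one, so it makes sense before any
  integrability is known. A \<^const>\<open>valid_path\<close> is differentiable outside finitely many parameters,
  which form a null set, so the arbitrary value of \<^const>\<open>vector_derivative\<close> there is harmless.
\<close>

definition path_integral :: "('a::euclidean_space \<Rightarrow> real) \<Rightarrow> (real \<Rightarrow> 'a) \<Rightarrow> ennreal" where
  "path_integral f \<gamma> =
     (\<integral>\<^sup>+ t \<in> {0..1}. ennreal (f (\<gamma> t) * norm (vector_derivative \<gamma> (at t))) \<partial>lborel)"

definition pseudometric :: "('a::euclidean_space \<Rightarrow> real) \<Rightarrow> 'a \<Rightarrow> 'a \<Rightarrow> ennreal" where
  "pseudometric f x y =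
     (INF \<gamma> \<in> {\<gamma>. valid_path \<gamma> \<and> pathstart \<gamma> = x \<and> pathfinish \<gamma> = y}. path_integral f \<gamma>)"

definition growing_ball :: "('a::euclidean_space \<Rightarrow> real) \<Rightarrow> real \<Rightarrow> 'a set" where
  "growing_ball f t = {x. pseudometric f 0 x \<le> ennreal t}"

definition translate :: "'a::euclidean_space \<Rightarrow> ('a \<Rightarrow> real) \<Rightarrow> ('a \<Rightarrow> real)" where
  "translate v f = (\<lambda>x. f (x + v))"

text \<open>
  The measurable space \<open>N\<close> of densities in which \<open>\<sigma>\<close> takes its values is arbitrary, apart from the
  requirement that the functionals whose expectation or law is considered be measurable. The product
  \<open>\<sigma>\<close>-algebra on functions is in general too small for this, as \<^const>\<open>pseudometric\<close> depends on
  uncountably many values of the density.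
\<close>

definition random_density ::
    "'w measure \<Rightarrow> ('a::euclidean_space \<Rightarrow> real) measure \<Rightarrow> ('w \<Rightarrow> 'a \<Rightarrow> real) \<Rightarrow> bool" where
  "random_density M N \<sigma> \<longleftrightarrow>
     prob_space M \<and> \<sigma> \<in> M \<rightarrow>\<^sub>M N \<and>
     (\<forall>f \<in> space N. \<forall>x. 0 \<le> f x) \<and>
     (\<forall>x. (\<lambda>f. path_integral f (linepath 0 x)) \<in> borel_measurable N) \<and>
     (\<forall>x y. (\<lambda>f. pseudometric f x y) \<in> borel_measurable N)"

definition law_invariant :: "'b measure \<Rightarrow> ('b \<Rightarrow> 'b) \<Rightarrow> bool" where
  "law_invariant P \<phi> \<longleftrightarrow> \<phi> \<in> P \<rightarrow>\<^sub>M P \<and> distr P P \<phi> = P"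

definition ergodic_for :: "'b measure \<Rightarrow> ('b \<Rightarrow> 'b) \<Rightarrow> bool" where
  "ergodic_for P \<phi> \<longleftrightarrow> law_invariant P \<phi> \<and>
     (\<forall>A \<in> sets P. \<phi> -` A \<inter> space P = A \<longrightarrow> measure P A = 0 \<or> measure P A = 1)"

text \<open>
  The deterministic limit of \<open>T(0, n v) / n\<close>, almost surely and in \<open>L\<^sup>1\<close>. The conversion
  \<^const>\<open>enn2real\<close> loses nothing when \<open>T\<close> is almost surely Lipschitz, hence finite. A limit in this
  sense is unique, so \<^const>\<open>The\<close> picks it whenever it exists.
\<close>

definition is_time_constant ::
    "'w measure \<Rightarrow> ('w \<Rightarrow> 'a::euclidean_space \<Rightarrow> real) \<Rightarrow> 'a \<Rightarrow> real \<Rightarrow> bool" where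
  "is_time_constant M \<sigma> v m \<longleftrightarrow>
     (AE \<omega> in M.
        (\<lambda>n::nat. enn2real (pseudometric (\<sigma> \<omega>) 0 (real n *\<^sub>R v)) / real n) \<longlonglongrightarrow> m) \<and>
     (\<lambda>n::nat. \<integral>\<^sup>+ \<omega>. ennreal \<bar>enn2real (pseudometric (\<sigma> \<omega>) 0 (real n *\<^sub>R v)) / real n - m\<bar> \<partial>M)
        \<longlonglongrightarrow> 0"

definition time_constant ::
    "'w measure \<Rightarrow> ('w \<Rightarrow> 'a::euclidean_space \<Rightarrow> real) \<Rightarrow> 'a \<Rightarrow> real" where
  "time_constant M \<sigma> v = (THE m. is_time_constant M \<sigma> v m)"

definition is_norm :: "('a::real_vector \<Rightarrow> real) \<Rightarrow> bool" where
  "is_norm p \<longleftrightarrow>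
     (\<forall>x. 0 \<le> p x) \<and> (\<forall>x. p x = 0 \<longleftrightarrow> x = 0) \<and>
     (\<forall>a x. p (a *\<^sub>R x) = \<bar>a\<bar> * p x) \<and> (\<forall>x y. p (x + y) \<le> p x + p y)"

definition dilate :: "real \<Rightarrow> 'a::real_vector set \<Rightarrow> 'a set" where
  "dilate c S = (\<lambda>x. c *\<^sub>R x) ` S"

end

theory Submission
  imports Defs
begin

text \<open>
  The limit \<open>\<mu>(v)\<close> exists by Kingman's subadditive ergodic theorem, since \<open>T(0, n v)\<close> is subadditive
  along the orbit of the translation by \<open>v\<close> and lies between \<open>0\<close> and \<open>C n \<bar>v\<bar>\<close>. The lower bound
  in Kingman's theorem is a covering argument: if \<open>liminf F\<^sub>n / n < b\<close> with positive probability, hence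
  almost surely by ergodicity, then every long orbit segment is cut, up to a small proportion, into blocks
  of length \<open>n\<close> on which \<open>F\<^sub>n \<le> b n\<close>, so that the means of \<open>F\<^sub>n / n\<close> are eventually close to \<open>b\<close> or below. Applied
  to the sums of a bounded function \<open>g\<close> and of \<open>C - g\<close>, this lower bound gives Birkhoff's theorem, and
  Birkhoff's theorem for the powers of the translation gives the upper bound in Kingman's theorem.

  As \<open>T\<close> and \<open>\<mu>\<close> are both \<open>C\<close>-Lipschitz, convergence in the finitely many directions of a net of the
  sphere yields, almost surely and for each \<open>\<eta> > 0\<close>, a bound \<open>\<bar>T(0, x) - \<mu>(x)\<bar> \<le> A + \<eta> \<bar>x\<bar>\<close> for all \<open>x\<close>,
  from which the inclusions between \<open>B\<^sub>t / t\<close> and the dilates of \<open>K\<close> are read off.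
\<close>

subsection \<open>The subadditive ergodic theorem\<close>

text \<open>The orbit is cut greedily from the left. A point of \<open>B\<close> costs one step and
  at most \<open>C\<close>; any other point starts a block of some length \<open>n \<le> N\<close>
  that costs at most \<open>b * n\<close>. A last block that would overshoot is replaced by the
  remaining piece, shorter than \<open>N\<close>, which costs at most \<open>C * N\<close>; this
  happens only once. Strong induction on \<open>L\<close> carries this out.\<close>

lemma subadditive_cover:
  fixes F :: "nat \<Rightarrow> 'b \<Rightarrow> real"
  assumes upper: "\<And>n x. x \<in> X \<Longrightarrow> F n x \<le> C * real n"
    and sub: "\<And>m n x. x \<in> X \<Longrightarrow> F (m + n) x \<le> F m x + F n ((\<tau> ^^ m) x)"
    and maps: "\<And>x. x \<in> X \<Longrightarrow> \<tau> x \<in> X"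
    and C: "0 \<le> C" and b: "0 \<le> b"
    and good: "\<And>x. x \<in> X \<Longrightarrow> x \<notin> B \<Longrightarrow> \<exists>n\<in>{1..N}. F n x \<le> b * real n"
    and x: "x \<in> X"
  shows "F L x \<le> b * real L + C * (\<Sum>j<L. indicator B ((\<tau> ^^ j) x)) + C * real N"
  using x
proof (induction L arbitrary: x rule: less_induct)
  case (less L)
  have pos: "0 \<le> (\<Sum>j<k. indicator B ((\<tau> ^^ j) y) :: real)" for k :: nat and y
    by (intro sum_nonneg) auto
  have mapsn: "(\<tau> ^^ n) x \<in> X" for n
    by (induction n) (auto simp: maps less.prems)
  have split: "(\<Sum>j<m + k. indicator B ((\<tau> ^^ j) x) :: real)
      = (\<Sum>j<m. indicator B ((\<tau> ^^ j) x)) + (\<Sum>j<k. indicator B ((\<tau> ^^ j) ((\<tau> ^^ m) x)))" for m k :: nat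
  proof (induction k)
    case (Suc k)
    then show ?case by (simp add: add.commute[of m k] funpow_add)
  qed simp
  consider "L = 0" | "L > 0" "x \<in> B" | n where "n \<in> {1..N}" "F n x \<le> b * real n" "L > 0"
    using good[OF less.prems] by blast
  then show ?case
  proof cases
    case 1
    have "F 0 x \<le> 0" "0 \<le> C * real N" using upper[OF less.prems, of 0] C by simp_all
    then show ?thesis using 1 by simp
  next
    case 2
    then obtain k where L: "L = 1 + k" by (metis Suc_diff_1 plus_1_eq_Suc)
    have "F L x \<le> F 1 x + F k ((\<tau> ^^ 1) x)" unfolding L by (rule sub[OF less.prems])
    also have "F 1 x \<le> C" using upper[OF less.prems, of 1] by simp
    also have "F k ((\<tau> ^^ 1) x) \<le> b * real k + C * (\<Sum>j<k. indicator B ((\<tau> ^^ j) ((\<tau> ^^ 1) x))) + C * real N"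
      by (rule less.IH) (use L mapsn[of 1] in auto)
    finally have "F L x \<le> b * real k + C * (1 + (\<Sum>j<k. indicator B ((\<tau> ^^ j) ((\<tau> ^^ 1) x)))) + C * real N"
      by (simp add: algebra_simps)
    also have "1 + (\<Sum>j<k. indicator B ((\<tau> ^^ j) ((\<tau> ^^ 1) x))) = (\<Sum>j<L. indicator B ((\<tau> ^^ j) x) :: real)"
      unfolding L split using 2 by simp
    finally show ?thesis using b L by (simp add: algebra_simps)
  next
    case 3
    show ?thesis
    proof (cases "n \<le> L")
      case True
      then obtain k where L: "L = n + k" using le_iff_add by auto
      have "F L x \<le> F n x + F k ((\<tau> ^^ n) x)" unfolding L by (rule sub[OF less.prems])
      also have "F k ((\<tau> ^^ n) x) \<le> b * real k + C * (\<Sum>j<k. indicator B ((\<tau> ^^ j) ((\<tau> ^^ n) x))) + C * real N"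
        by (rule less.IH) (use L 3 mapsn in auto)
      also have "C * (\<Sum>j<k. indicator B ((\<tau> ^^ j) ((\<tau> ^^ n) x))) \<le> C * (\<Sum>j<L. indicator B ((\<tau> ^^ j) x))"
        unfolding L split using C pos by (intro mult_left_mono) auto
      finally show ?thesis using 3 L by (simp add: algebra_simps)
    next
      case False
      then have "F L x \<le> C * real N"
        using upper[OF less.prems, of L] C 3 mult_left_mono[of "real L" "real N" C] by simp
      moreover have "0 \<le> b * real L" "0 \<le> C * (\<Sum>j<L. indicator B ((\<tau> ^^ j) x))"
        using b C pos by simp_all
      ultimately show ?thesis by simp
    qed
  qed
qed

lemma measure_preserving_funpow:
  assumes "law_invariant P \<tau>"
  shows "law_invariant P (\<tau> ^^ n)"
proof (induction n)
  case 0
  have "distr P P (\<tau> ^^ 0) = P" by (simp add: id_def distr_id)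
  then show ?case by (simp add: law_invariant_def)
next
  case (Suc n)
  have [measurable]: "\<tau> \<in> P \<rightarrow>\<^sub>M P" "(\<tau> ^^ n) \<in> P \<rightarrow>\<^sub>M P"
    and eq: "distr P P \<tau> = P" "distr P P (\<tau> ^^ n) = P"
    using assms Suc by (auto simp: law_invariant_def)
  have "distr P P (\<tau> \<circ> (\<tau> ^^ n)) = distr (distr P P (\<tau> ^^ n)) P \<tau>"
    by (subst distr_distr) auto
  also have "\<dots> = P" using eq by simp
  finally have "distr P P (\<tau> \<circ> (\<tau> ^^ n)) = P" .
  moreover have "\<tau> \<circ> (\<tau> ^^ n) \<in> P \<rightarrow>\<^sub>M P" by (rule measurable_comp) measurable
  ultimately show ?case by (simp add: law_invariant_def del: o_apply)
qed

lemma integral_law_invariant: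
  fixes g :: "'b \<Rightarrow> real"
  assumes "law_invariant P \<phi>" "g \<in> borel_measurable P"
  shows "(\<integral>x. g (\<phi> x) \<partial>P) = (\<integral>x. g x \<partial>P)"
  using assms integral_distr[of \<phi> P P g] by (simp add: law_invariant_def)

text \<open>By \<open>super\<close>, and by \<open>sub\<close> with \<open>m = 1\<close>, the values
  \<open>F n (\<tau> x)\<close> and \<open>F (Suc n) x\<close> differ by a bounded amount. The lower
  limit is therefore exactly invariant, as \<open>ergodic_for\<close> demands, and the event that it
  lies below \<open>b\<close> has probability 0 or 1. Integrating the covering bound excludes
  probability 1 when \<open>b < c\<close>.\<close>

lemma subadditive_liminf_ge:
  fixes F :: "nat \<Rightarrow> 'b \<Rightarrow> real"
  assumes "prob_space P" and erg: "ergodic_for P \<tau>"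
    and F: "\<And>n. F n \<in> borel_measurable P"
    and lower: "\<And>n x. x \<in> space P \<Longrightarrow> 0 \<le> F n x"
    and upper: "\<And>n x. x \<in> space P \<Longrightarrow> F n x \<le> C * real n"
    and sub: "\<And>m n x. x \<in> space P \<Longrightarrow> F (m + n) x \<le> F m x + F n ((\<tau> ^^ m) x)"
    and super: "\<And>n x. x \<in> space P \<Longrightarrow> F n (\<tau> x) \<le> D + F (Suc n) x"
    and mean: "\<And>n. n \<ge> 1 \<Longrightarrow> c * real n \<le> (\<integral>x. F n x \<partial>P)"
  shows "AE x in P. ereal c \<le> liminf (\<lambda>n. ereal (F n x / real n))"
proof -
  interpret prob_space P by fact
  note F[measurable]
  have inv: "law_invariant P \<tau>" using erg by (simp add: ergodic_for_def)
  then have [measurable]: "\<tau> \<in> P \<rightarrow>\<^sub>M P" by (simp add: law_invariant_def)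
  have maps: "\<tau> x \<in> space P" if "x \<in> space P" for x
    using that by (rule measurable_space[rotated]) measurable
  obtain x0 where x0: "x0 \<in> space P" using not_empty by blast
  have C: "0 \<le> C" using lower[OF x0, of 1] upper[OF x0, of 1] by simp
  define l where "l x = liminf (\<lambda>n. ereal (F n x / real n))" for x
  have [measurable]: "l \<in> borel_measurable P" unfolding l_def by measurable
  have l_inv: "l (\<tau> x) = l x" if x: "x \<in> space P" for x
  proof -
    define u where "u n = F (Suc n) x / real (Suc n)" for n
    define e where "e n = F n (\<tau> x) / real n - u n" for n
    define A where "A = \<bar>C\<bar> + \<bar>D\<bar>"
    \<comment> \<open>\<open>A\<close> bounds the effect of the shift by either \<open>C\<close> or
      \<open>D\<close>, whatever the sign of \<open>D\<close>. The further \<open>C\<close> pays for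
      dividing by \<open>n\<close> on one side and by \<open>n + 1\<close> on the other, a mismatch
      of \<open>u n \<le> C\<close> before division.\<close>
    have e: "norm (e n) \<le> (A + C) / real n" if n: "n \<ge> 1" for n
    proof -
      have u: "0 \<le> u n" "u n \<le> C"
        using lower[OF x, of "Suc n"] upper[OF x, of "Suc n"]
        by (auto simp: u_def divide_simps)
      have "u n * real (Suc n) = F (Suc n) x" by (simp add: u_def del: of_nat_Suc)
      then have "F (Suc n) x = u n * real n + u n" by (simp add: algebra_simps)
      moreover have "F (Suc n) x \<le> C + F n (\<tau> x)"
        using sub[OF x, of 1 n] upper[OF x, of 1] by simp
      ultimately have "\<bar>F n (\<tau> x) - u n * real n\<bar> \<le> A + C"
        using super[OF x, of n] u unfolding A_def by linarith
      moreover have "e n = (F n (\<tau> x) - u n * real n) / real n"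
        using n by (simp add: e_def field_simps)
      ultimately show ?thesis using n by (simp add: divide_right_mono)
    qed
    have "(\<lambda>n. (A + C) / real n) \<longlonglongrightarrow> 0" by (rule lim_const_over_n)
    then have "e \<longlonglongrightarrow> 0"
      by (rule Lim_null_comparison[rotated]) (use e in \<open>auto simp: eventually_sequentially\<close>)
    then have "(\<lambda>n. ereal (e n)) \<longlonglongrightarrow> 0" by (simp add: zero_ereal_def)
    then have "liminf (\<lambda>n. ereal (e n) + ereal (u n)) = 0 + liminf (\<lambda>n. ereal (u n))"
      by (rule ereal_liminf_lim_add) simp
    moreover have "liminf (\<lambda>n. ereal (u n)) = l x"
      unfolding l_def u_def using liminf_shift[of "\<lambda>n. ereal (F n x / real n)"] by simp
    moreover have "ereal (e n) + ereal (u n) = ereal (F n (\<tau> x) / real n)" for n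
      by (simp add: e_def)
    ultimately show ?thesis by (simp add: l_def)
  qed
  have null: "AE x in P. ereal b \<le> l x" if b: "0 \<le> b" "b < c" for b
  proof -
    define A where "A = {x\<in>space P. l x < ereal b}"
    have [measurable]: "A \<in> sets P" unfolding A_def by measurable
    have "\<tau> -` A \<inter> space P = A" using l_inv maps by (auto simp: A_def)
    then have "prob A = 0 \<or> prob A = 1" using erg by (simp add: ergodic_for_def)
    moreover have False if "prob A = 1"
    proof -
      \<comment> \<open>\<open>A' N\<close> collects the points at which a good block of length at
        most \<open>N\<close> starts. These sets increase and cover \<open>A\<close>, so for large
        \<open>N\<close> the bad set \<open>B\<close> has small probability.\<close>
      define A' where "A' N = {x\<in>space P. \<exists>n\<in>{1..N}. F n x \<le> b * real n}" for N
      have [measurable]: "A' N \<in> sets P" for N unfolding A'_def by measurable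
      have "A \<subseteq> (\<Union>N. A' N)"
      proof
        fix x assume x: "x \<in> A"
        have "\<exists>n\<ge>1. F n x < b * real n"
        proof (rule ccontr)
          assume "\<not> ?thesis"
          then have "ereal b \<le> ereal (F n x / real n)" if "n \<ge> 1" for n
            using that by (auto simp: field_simps not_less)
          then have "ereal b \<le> l x" unfolding l_def
            by (intro Liminf_bounded) (auto simp: eventually_sequentially)
          then show False using x by (auto simp: A_def)
        qed
        then obtain n where "n \<ge> 1" "F n x < b * real n" by blast
        then show "x \<in> (\<Union>N. A' N)" using x by (auto simp: A_def A'_def intro!: exI[of _ n] bexI[of _ n])
      qed
      then have one: "prob (\<Union>N. A' N) = 1"
        using finite_measure_mono[of A "\<Union>N. A' N"] that by (intro antisym) auto
      have "incseq A'" unfolding A'_def incseq_def by force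
      then have "(\<lambda>N. prob (A' N)) \<longlonglongrightarrow> 1"
        unfolding one[symmetric] by (intro finite_Lim_measure_incseq) auto
      \<comment> \<open>Chosen so that \<open>C * \<delta> \<le> (c - b) / 2\<close>; the
        \<open>+ 1\<close> avoids a division by zero when \<open>C = 0\<close>.\<close>
      moreover define \<delta> where "\<delta> = (c - b) / (2 * (C + 1))"
      have "\<delta> > 0" using b C by (simp add: \<delta>_def)
      ultimately have "eventually (\<lambda>N. 1 - \<delta> < prob (A' N)) sequentially"
        by (intro order_tendstoD) auto
      then obtain N where N: "1 - \<delta> < prob (A' N)" by (auto simp: eventually_sequentially)
      define B where "B = space P - A' N"
      have [measurable]: "B \<in> sets P" unfolding B_def by measurable
      have PB: "prob B \<le> \<delta>" using N by (simp add: B_def prob_compl)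
      \<comment> \<open>Integration of the covering bound: as the iterates preserve
        \<open>P\<close>, each of the \<open>L\<close> indicators has mean
        \<open>prob B\<close>.\<close>
      have bound: "c * real L \<le> b * real L + C * (real L * prob B) + C * real N" if L: "L \<ge> 1" for L
      proof -
        have ind: "integrable P (\<lambda>x. indicator B ((\<tau> ^^ j) x) :: real)" for j
          by (rule integrable_const_bound[of _ 1]) auto
        have "(\<integral>x. indicator B ((\<tau> ^^ j) x) \<partial>P) = prob B" for j
          using integral_law_invariant[OF measure_preserving_funpow[OF inv, of j], of "indicator B"] by simp
        then have rhs: "(\<integral>x. b * real L + C * (\<Sum>j<L. indicator B ((\<tau> ^^ j) x)) + C * real N \<partial>P)
            = b * real L + C * (real L * prob B) + C * real N"
          using ind by (simp add: prob_space)
        have "(\<integral>x. F L x \<partial>P) \<le> (\<integral>x. b * real L + C * (\<Sum>j<L. indicator B ((\<tau> ^^ j) x)) + C * real N \<partial>P)"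
        proof (rule integral_mono)
          show "integrable P (F L)"
            by (rule integrable_const_bound[of _ "C * real L"]) (use lower upper in auto)
          show "integrable P (\<lambda>x. b * real L + C * (\<Sum>j<L. indicator B ((\<tau> ^^ j) x)) + C * real N)"
            using ind by auto
          show "F L x \<le> b * real L + C * (\<Sum>j<L. indicator B ((\<tau> ^^ j) x)) + C * real N"
            if "x \<in> space P" for x
            by (rule subadditive_cover[OF upper sub maps C b(1) _ that])
               (auto simp: B_def A'_def)
        qed
        then show ?thesis using mean[OF L] rhs by simp
      qed
      have "C * prob B \<le> C * \<delta>" using PB C by (rule mult_left_mono)
      also have "\<dots> \<le> (c - b) / 2" using C b by (simp add: \<delta>_def divide_simps)
      finally have half: "C * prob B \<le> (c - b) / 2" .
      \<comment> \<open>The bad points use up at most half of the gap \<open>c - b\<close>, which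
        leaves \<open>(c - b) * L \<le> 2 * C * N\<close>. This fails for large \<open>L\<close>,
        since \<open>N\<close> is already fixed.\<close>
      obtain L :: nat where L: "real L > 2 * (C * real N) / (c - b)" using reals_Archimedean2 by blast
      have "L \<ge> 1" using L C b
        by (metis One_nat_def Suc_leI diff_gt_0_iff_gt divide_nonneg_pos leD mult_nonneg_nonneg not_gr_zero
          of_nat_0 of_nat_0_le_iff zero_le_numeral)
      from bound[OF this] have "(c - b) * real L \<le> (C * prob B) * real L + C * real N"
        by (simp add: algebra_simps)
      also have "\<dots> \<le> (c - b) / 2 * real L + C * real N"
        by (intro add_right_mono mult_right_mono half) simp
      finally have "(c - b) * real L \<le> 2 * (C * real N)" by (simp add: field_simps)
      then show False using L b by (simp add: field_simps)
    qed
    ultimately have "prob A = 0" by blast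
    then have "AE x in P. x \<notin> A" by (simp add: prob_eq_0)
    then show ?thesis by (auto simp: A_def elim!: AE_mp)
  qed
  \<comment> \<open>The level \<open>b\<close> increases to \<open>c\<close> along a sequence, at
    the price of countably many null sets. Negative levels are covered by
    \<open>0 \<le> l x\<close>.\<close>
  have "AE x in P. \<forall>k::nat. ereal (c - 1 / real (Suc k)) \<le> l x"
    unfolding AE_all_countable
  proof
    fix k
    show "AE x in P. ereal (c - 1 / real (Suc k)) \<le> l x"
    proof (cases "0 \<le> c - 1 / real (Suc k)")
      case True
      then show ?thesis by (intro null) auto
    next
      case False
      have "0 \<le> l x" if "x \<in> space P" for x
        unfolding l_def using lower[OF that] by (intro Liminf_bounded) auto
      moreover have "ereal (c - 1 / real (Suc k)) \<le> 0" using False by simp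
      ultimately show ?thesis by (intro AE_I2) (meson order_trans)
    qed
  qed
  then show ?thesis
  proof eventually_elim
    case (elim x)
    have "(\<lambda>k. c - 1 / real (Suc k)) \<longlonglongrightarrow> c - 0"
      by (intro tendsto_intros LIMSEQ_Suc[OF lim_const_over_n])
    then have "(\<lambda>k. ereal (c - 1 / real (Suc k))) \<longlonglongrightarrow> ereal c" by simp
    then show ?case unfolding l_def[symmetric]
      by (rule LIMSEQ_le_const2) (use elim in auto)
  qed
qed

section \<open>Birkhoff's theorem for bounded functions\<close>

text \<open>Orbit sums satisfy \<open>sub\<close> with equality. The choice \<open>D = 0\<close>
  works because passing from \<open>x\<close> to \<open>\<tau> x\<close> only drops the nonnegative
  term \<open>g x\<close>.\<close>

lemma birkhoff_liminf_ge:
  fixes g :: "'b \<Rightarrow> real"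
  assumes P: "prob_space P" and erg: "ergodic_for P \<tau>"
    and g[measurable]: "g \<in> borel_measurable P"
    and bounds: "\<And>x. x \<in> space P \<Longrightarrow> 0 \<le> g x" "\<And>x. x \<in> space P \<Longrightarrow> g x \<le> C"
  shows "AE x in P. ereal (\<integral>x. g x \<partial>P) \<le> liminf (\<lambda>n. ereal ((\<Sum>j<n. g ((\<tau> ^^ j) x)) / real n))"
proof -
  interpret prob_space P by fact
  have inv: "law_invariant P \<tau>" using erg by (simp add: ergodic_for_def)
  then have [measurable]: "\<tau> \<in> P \<rightarrow>\<^sub>M P" by (simp add: law_invariant_def)
  have maps: "(\<tau> ^^ j) x \<in> space P" if "x \<in> space P" for x j
    using that by (rule measurable_space[rotated]) measurable
  have int: "integrable P (\<lambda>x. g ((\<tau> ^^ j) x))" for j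
    by (rule integrable_const_bound[of _ C]) (auto simp: bounds maps)
  show ?thesis
  proof (rule subadditive_liminf_ge[OF P erg, where C = C and D = 0])
    show "(\<lambda>x. \<Sum>j<n. g ((\<tau> ^^ j) x)) \<in> borel_measurable P" for n by measurable
    fix n x assume x: "x \<in> space P"
    show "0 \<le> (\<Sum>j<n. g ((\<tau> ^^ j) x))" by (intro sum_nonneg bounds maps x)
    show "(\<Sum>j<n. g ((\<tau> ^^ j) x)) \<le> C * real n"
      using sum_bounded_above[of "{..<n}" "\<lambda>j. g ((\<tau> ^^ j) x)" C] bounds(2)[OF maps[OF x]]
      by (simp add: mult.commute)
    show "(\<Sum>j<m + n. g ((\<tau> ^^ j) x)) \<le> (\<Sum>j<m. g ((\<tau> ^^ j) x)) + (\<Sum>j<n. g ((\<tau> ^^ j) ((\<tau> ^^ m) x)))" for m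
    proof (induction n)
      case (Suc n)
      then show ?case by (simp add: add.commute[of m n] funpow_add)
    qed simp
    show "(\<Sum>j<n. g ((\<tau> ^^ j) (\<tau> x))) \<le> 0 + (\<Sum>j<Suc n. g ((\<tau> ^^ j) x))"
      unfolding sum.lessThan_Suc_shift using bounds(1)[OF x] by (simp add: funpow_swap1)
  next
    fix n :: nat
    have "(\<integral>x. g ((\<tau> ^^ j) x) \<partial>P) = (\<integral>x. g x \<partial>P)" for j
      by (rule integral_law_invariant[OF measure_preserving_funpow[OF inv] g])
    then show "(\<integral>x. g x \<partial>P) * real n \<le> (\<integral>x. (\<Sum>j<n. g ((\<tau> ^^ j) x)) \<partial>P)"
      using int by simp
  qed
qed

lemma liminf_ge_eventually_less:
  fixes u :: "nat \<Rightarrow> real"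
  assumes "ereal c \<le> liminf (\<lambda>n. ereal (u n))" "a < c"
  shows "eventually (\<lambda>n. a < u n) sequentially"
proof -
  have "ereal a < liminf (\<lambda>n. ereal (u n))"
    using assms by (meson ereal_less(2) less_ereal.simps(1) order_less_le_trans)
  then have "eventually (\<lambda>n. ereal a < ereal (u n)) sequentially"
    by (rule less_LiminfD)
  then show ?thesis by simp
qed

text \<open>The function \<open>C - g\<close> also takes values between 0 and \<open>C\<close>, and
  its lower bound is the upper bound for \<open>g\<close>.\<close>

lemma birkhoff_bounded:
  fixes g :: "'b \<Rightarrow> real"
  assumes P: "prob_space P" and erg: "ergodic_for P \<tau>"
    and g[measurable]: "g \<in> borel_measurable P"
    and bounds: "\<And>x. x \<in> space P \<Longrightarrow> 0 \<le> g x" "\<And>x. x \<in> space P \<Longrightarrow> g x \<le> C"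
  shows "AE x in P. (\<lambda>n. (\<Sum>j<n. g ((\<tau> ^^ j) x)) / real n) \<longlonglongrightarrow> (\<integral>x. g x \<partial>P)"
proof -
  interpret prob_space P by fact
  have "integrable P g"
    by (rule integrable_const_bound[of _ C]) (auto simp: bounds)
  then have mean: "(\<integral>x. C - g x \<partial>P) = C - (\<integral>x. g x \<partial>P)" by (simp add: prob_space)
  have "AE x in P. ereal (\<integral>x. C - g x \<partial>P) \<le> liminf (\<lambda>n. ereal ((\<Sum>j<n. C - g ((\<tau> ^^ j) x)) / real n))"
    by (rule birkhoff_liminf_ge[OF P erg, where C = C]) (auto simp: bounds)
  moreover have "AE x in P. ereal (\<integral>x. g x \<partial>P) \<le> liminf (\<lambda>n. ereal ((\<Sum>j<n. g ((\<tau> ^^ j) x)) / real n))"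
    by (rule birkhoff_liminf_ge[OF P erg g bounds])
  ultimately show ?thesis
  proof eventually_elim
    case (elim x)
    show ?case
    proof (rule order_tendstoI)
      fix a assume "a < (\<integral>x. g x \<partial>P)"
      then show "\<forall>\<^sub>F n in sequentially. a < (\<Sum>j<n. g ((\<tau> ^^ j) x)) / real n"
        using elim(2) by (rule liminf_ge_eventually_less[rotated])
    next
      fix a assume "(\<integral>x. g x \<partial>P) < a"
      then have "C - a < (\<integral>x. C - g x \<partial>P)" using mean by simp
      then have "\<forall>\<^sub>F n in sequentially. C - a < (\<Sum>j<n. C - g ((\<tau> ^^ j) x)) / real n"
        using elim(1) by (rule liminf_ge_eventually_less[rotated])
      \<comment> \<open>The index 0 has to be left out: there both quotients are 0 and do not add up
        to \<open>C\<close>.\<close>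
      then show "\<forall>\<^sub>F n in sequentially. (\<Sum>j<n. g ((\<tau> ^^ j) x)) / real n < a"
        using eventually_gt_at_top[of 0]
        by eventually_elim (simp add: sum_subtractf field_simps)
    qed
  qed
qed

section \<open>Convergence in Kingman's theorem\<close>

lemma tendsto_div_blocks:
  assumes k: "k > 0"
  shows "(\<lambda>n. real (n div k) / real n) \<longlonglongrightarrow> 1 / real k"
proof -
  have "norm (real (n div k) / real n - 1 / real k) \<le> 1 / real n" if n: "n \<ge> 1" for n
  proof -
    have "real n = real (n div k) * real k + real (n mod k)"
      by (metis div_mult_mod_eq of_nat_add of_nat_mult)
    then have "real (n div k) / real n - 1 / real k = - (real (n mod k) / real k) / real n"
      using k n by (simp add: field_simps)
    moreover have "real (n mod k) / real k \<le> 1" "0 \<le> real n" using k by (simp_all add: less_imp_le)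
    ultimately have "norm (real (n div k) / real n - 1 / real k) = (real (n mod k) / real k) / real n"
      by simp
    also have "\<dots> \<le> 1 / real n" by (rule divide_right_mono) fact+
    finally show ?thesis .
  qed
  then have "(\<lambda>n. real (n div k) / real n - 1 / real k) \<longlonglongrightarrow> 0"
    by (intro Lim_null_comparison[OF _ lim_const_over_n[of 1]]) (auto simp: eventually_sequentially)
  then show ?thesis by (rule LIM_zero_cancel)
qed

text \<open>The limit is the infimum of the means \<open>E n / n\<close>. For the upper bound the
  orbit is cut into blocks of a fixed length \<open>k\<close>, and \<open>F k\<close> is averaged
  along the orbit of \<open>\<tau> ^^ k\<close>. That average is the constant \<open>E k\<close>
  because the powers of \<open>\<tau>\<close> are assumed ergodic as well; ergodicity of
  \<open>\<tau>\<close> alone does not pass to its powers.\<close>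

theorem subadditive_ergodic:
  fixes F :: "nat \<Rightarrow> 'b \<Rightarrow> real"
  assumes P: "prob_space P" and erg: "\<And>k. k \<ge> 1 \<Longrightarrow> ergodic_for P (\<tau> ^^ k)"
    and F: "\<And>n. F n \<in> borel_measurable P"
    and lower: "\<And>n x. x \<in> space P \<Longrightarrow> 0 \<le> F n x"
    and upper: "\<And>n x. x \<in> space P \<Longrightarrow> F n x \<le> C * real n"
    and sub: "\<And>m n x. x \<in> space P \<Longrightarrow> F (m + n) x \<le> F m x + F n ((\<tau> ^^ m) x)"
    and super: "\<And>n x. x \<in> space P \<Longrightarrow> F n (\<tau> x) \<le> D + F (Suc n) x"
  shows "\<exists>c. AE x in P. (\<lambda>n. F n x / real n) \<longlonglongrightarrow> c"
proof -
  interpret prob_space P by fact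
  note F[measurable]
  have erg1: "ergodic_for P \<tau>" using erg[of 1] by simp
  then have [measurable]: "\<tau> \<in> P \<rightarrow>\<^sub>M P" by (simp add: law_invariant_def ergodic_for_def)
  have maps: "(\<tau> ^^ j) x \<in> space P" if "x \<in> space P" for x j
    using that by (rule measurable_space[rotated]) measurable
  obtain x0 where x0: "x0 \<in> space P" using not_empty by blast
  have C: "0 \<le> C" using lower[OF x0, of 1] upper[OF x0, of 1] by simp
  define E where "E n = (\<integral>x. F n x \<partial>P)" for n
  define c where "c = (INF n\<in>{1..}. E n / real n)"
  have E0: "0 \<le> E n" for n unfolding E_def by (intro integral_nonneg_AE AE_I2 lower)
  have bdd: "bdd_below ((\<lambda>n. E n / real n) ` {1..})"
    by (rule bdd_belowI[of _ 0]) (auto simp: E0)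
  have "c \<le> E n / real n" if "n \<ge> 1" for n
    unfolding c_def using bdd that by (intro cINF_lower) auto
  then have "c * real n \<le> E n" if "n \<ge> 1" for n
    using that by (simp add: field_simps)
  then have liminf: "AE x in P. ereal c \<le> liminf (\<lambda>n. ereal (F n x / real n))"
    unfolding E_def by (intro subadditive_liminf_ge[OF P erg1 F lower upper sub super]) auto
  \<comment> \<open>All block lengths are treated outside one null set, because \<open>k\<close> is
    chosen later, depending on the level \<open>a\<close>.\<close>
  have "AE x in P. \<forall>k\<ge>1. (\<lambda>n. (\<Sum>j<n. F k (((\<tau> ^^ k) ^^ j) x)) / real n) \<longlonglongrightarrow> E k"
    unfolding AE_all_countable E_def
  proof (intro allI AE_impI)
    fix k :: nat assume "1 \<le> k"
    then show "AE x in P. (\<lambda>n. (\<Sum>j<n. F k (((\<tau> ^^ k) ^^ j) x)) / real n) \<longlonglongrightarrow> (\<integral>x. F k x \<partial>P)"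
      by (rule birkhoff_bounded[OF P erg F lower upper])
  qed
  with liminf have "AE x in P. (\<lambda>n. F n x / real n) \<longlonglongrightarrow> c"
    using AE_space
  proof eventually_elim
    case (elim x)
    note x = elim(3)
    show ?case
    proof (rule order_tendstoI)
      fix a assume "a < c"
      then show "\<forall>\<^sub>F n in sequentially. a < F n x / real n"
        using elim(1) by (rule liminf_ge_eventually_less[rotated])
    next
      fix a assume "c < a"
      then obtain k where k: "k \<ge> 1" "E k / real k < a"
        unfolding c_def using cINF_less_iff[OF _ bdd] by auto
      define S where "S n = (\<Sum>j<n. F k (((\<tau> ^^ k) ^^ j) x))" for n
      have F_le_S: "F (k * n) x \<le> S n" for n
      proof (induction n)
        case 0
        then show ?case using upper[OF x, of 0] by (simp add: S_def)
      next
        case (Suc n)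
        have "F (k * n + k) x \<le> F (k * n) x + F k ((\<tau> ^^ (k * n)) x)" by (rule sub[OF x])
        then show ?case using Suc by (simp add: S_def funpow_mult add.commute)
      qed
      \<comment> \<open>The remainder after the last full block is shorter than \<open>k\<close> and
        costs at most \<open>C * k\<close>. The main term is written as a product of two convergent
        factors, which is legitimate since \<open>n \<ge> k\<close> makes \<open>n div k\<close>
        positive.\<close>
      have bound: "F n x / real n \<le> S (n div k) / real (n div k) * (real (n div k) / real n) + C * real k / real n"
        if n: "n \<ge> k" for n
      proof -
        have "F n x = F (k * (n div k) + n mod k) x" by simp
        also have "\<dots> \<le> F (k * (n div k)) x + F (n mod k) ((\<tau> ^^ (k * (n div k))) x)"
          by (rule sub[OF x])
        also have "\<dots> \<le> S (n div k) + C * real (n mod k)"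
          by (intro add_mono F_le_S upper maps x)
        also have "\<dots> \<le> S (n div k) + C * real k"
          using C k by (intro add_left_mono mult_left_mono) (auto simp: less_imp_le)
        finally have "F n x / real n \<le> (S (n div k) + C * real k) / real n"
          by (rule divide_right_mono) simp
        moreover have "n div k > 0" using n k by (simp add: div_greater_zero_iff)
        ultimately show ?thesis by (simp add: add_divide_distrib)
      qed
      have "filterlim (\<lambda>n. n div k) at_top sequentially"
        unfolding filterlim_at_top
      proof
        fix Z
        show "\<forall>\<^sub>F n in sequentially. Z \<le> n div k"
          using k by (intro eventually_sequentiallyI[of "Z * k"]) (simp add: less_eq_div_iff_mult_less_eq)
      qed
      moreover have "(\<lambda>n. S n / real n) \<longlonglongrightarrow> E k" using elim(2) k by (auto simp: S_def)
      ultimately have "(\<lambda>n. S (n div k) / real (n div k)) \<longlonglongrightarrow> E k"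
        by (rule filterlim_compose[rotated])
      then have "(\<lambda>n. S (n div k) / real (n div k) * (real (n div k) / real n) + C * real k / real n)
          \<longlonglongrightarrow> E k * (1 / real k) + 0"
        using k by (intro tendsto_intros tendsto_div_blocks lim_const_over_n) auto
      then have "\<forall>\<^sub>F n in sequentially. S (n div k) / real (n div k) * (real (n div k) / real n) + C * real k / real n < a"
        using k by (intro order_tendstoD) auto
      then show "\<forall>\<^sub>F n in sequentially. F n x / real n < a"
        using eventually_ge_at_top[of k] by eventually_elim (use bound in force)
    qed
  qed
  then show ?thesis by blast
qed

subsection \<open>Triangle inequality and isometries\<close>

lemma valid_path_derivativeE:
  fixes \<gamma> :: "real \<Rightarrow> 'a::euclidean_space"
  assumes "valid_path \<gamma>"
  obtains S D where "finite S" "\<And>t. t \<in> {0..1} - S \<Longrightarrow> (\<gamma> has_vector_derivative D t) (at t)"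
    "continuous_on ({0..1} - S) D"
proof -
  obtain S where "finite S" "\<gamma> C1_differentiable_on {0..1} - S"
    using assms by (auto simp: valid_path_def piecewise_C1_differentiable_on_def)
  then show ?thesis using that unfolding C1_differentiable_on_def by blast
qed

text \<open>A finite set of parameters is null, so \<open>vector_derivative\<close> may be replaced
  by any function \<open>D\<close> that is the derivative elsewhere. This makes the integrand
  accessible to explicit computation.\<close>

lemma path_integral_eq:
  fixes \<gamma> :: "real \<Rightarrow> 'a::euclidean_space"
  assumes S: "finite S" and D: "\<And>t. t \<in> {0..1} - S \<Longrightarrow> (\<gamma> has_vector_derivative D t) (at t)"
  shows "path_integral f \<gamma> = (\<integral>\<^sup>+ t. ennreal (f (\<gamma> t) * norm (D t)) * indicator ({0..1} - S) t \<partial>lborel)"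
  unfolding path_integral_def
proof (rule nn_integral_cong_AE)
  have "AE t in lborel. t \<notin> S"
    using S by (intro AE_not_in finite_imp_null_set_lborel)
  then show "AE t in lborel. ennreal (f (\<gamma> t) * norm (vector_derivative \<gamma> (at t))) * indicator {0..1} t
      = ennreal (f (\<gamma> t) * norm (D t)) * indicator ({0..1} - S) t"
  proof eventually_elim
    case (elim t)
    then show ?case using vector_derivative_at[OF D[of t]] by (auto simp: indicator_def)
  qed
qed

text \<open>Orthogonal maps preserve the norm of the velocity. The form \<open>R x + v\<close>
  treats translations (\<open>R\<close> the identity) and orthogonal maps (\<open>v = 0\<close>)
  together.\<close>

lemma path_integral_isometry:
  fixes \<gamma> :: "real \<Rightarrow> 'a::euclidean_space" and R :: "'a \<Rightarrow> 'a"
  assumes R: "orthogonal_transformation R" and \<gamma>: "valid_path \<gamma>"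
  shows "valid_path (\<lambda>t. R (\<gamma> t) + v)"
    and "path_integral f (\<lambda>t. R (\<gamma> t) + v) = path_integral (\<lambda>x. f (R x + v)) \<gamma>"
proof -
  have lin: "bounded_linear R"
    using orthogonal_transformation_linear[OF R] by (simp add: linear_conv_bounded_linear)
  obtain S D where S: "finite S" and D: "\<And>t. t \<in> {0..1} - S \<Longrightarrow> (\<gamma> has_vector_derivative D t) (at t)"
    and cont: "continuous_on ({0..1} - S) D"
    using valid_path_derivativeE[OF \<gamma>] by blast
  have RD: "((\<lambda>t. R (\<gamma> t) + v) has_vector_derivative R (D t)) (at t)" if "t \<in> {0..1} - S" for t
    using bounded_linear.has_vector_derivative[OF lin D[OF that]]
    by (simp add: has_vector_derivative_add_const)
  have "continuous_on {0..1} \<gamma>"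
    using \<gamma> by (simp add: valid_path_def piecewise_C1_differentiable_on_def)
  then have "continuous_on {0..1} (\<lambda>t. R (\<gamma> t) + v)"
    by (intro continuous_intros bounded_linear.continuous_on[OF lin])
  moreover have "continuous_on ({0..1} - S) (\<lambda>t. R (D t))"
    by (intro bounded_linear.continuous_on[OF lin] cont)
  then have "(\<lambda>t. R (\<gamma> t) + v) C1_differentiable_on {0..1} - S"
    unfolding C1_differentiable_on_def using RD by (intro exI[of _ "\<lambda>t. R (D t)"]) simp
  ultimately show "valid_path (\<lambda>t. R (\<gamma> t) + v)"
    unfolding valid_path_def piecewise_C1_differentiable_on_def using S by blast
  show "path_integral f (\<lambda>t. R (\<gamma> t) + v) = path_integral (\<lambda>x. f (R x + v)) \<gamma>"
    using path_integral_eq[OF S D, of "\<lambda>x. f (R x + v)"] path_integral_eq[OF S RD, of f]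
    by (simp add: orthogonal_transformation_norm[OF R])
qed

text \<open>Pushing paths forward gives one inequality. The same inequality for the inverse
  isometry, which sends \<open>z\<close> to \<open>Q z - Q v\<close> with \<open>Q\<close> the
  inverse of \<open>R\<close>, gives the other.\<close>

lemma pseudometric_isometry:
  fixes f :: "'a::euclidean_space \<Rightarrow> real" and R :: "'a \<Rightarrow> 'a"
  assumes R: "orthogonal_transformation R"
  shows "pseudometric (\<lambda>x. f (R x + v)) x y = pseudometric f (R x + v) (R y + v)"
proof -
  have le: "pseudometric f (R x + v) (R y + v) \<le> pseudometric (\<lambda>x. f (R x + v)) x y"
    if R: "orthogonal_transformation R" for R :: "'a \<Rightarrow> 'a" and f :: "'a \<Rightarrow> real" and v x y
    unfolding pseudometric_def
  proof (rule INF_mono)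
    fix \<gamma> assume \<gamma>: "\<gamma> \<in> {\<gamma>. valid_path \<gamma> \<and> pathstart \<gamma> = x \<and> pathfinish \<gamma> = y}"
    then show "\<exists>\<gamma>'\<in>{\<gamma>. valid_path \<gamma> \<and> pathstart \<gamma> = R x + v \<and> pathfinish \<gamma> = R y + v}.
        path_integral f \<gamma>' \<le> path_integral (\<lambda>x. f (R x + v)) \<gamma>"
      by (intro bexI[of _ "\<lambda>t. R (\<gamma> t) + v"])
         (auto simp: path_integral_isometry[OF R] pathstart_def pathfinish_def)
  qed
  define Q where "Q = inv R"
  have Q: "orthogonal_transformation Q" unfolding Q_def by (rule orthogonal_transformation_inv[OF R])
  have RQ: "R (Q z) = z" "Q (R z) = z" for z
    unfolding Q_def
    by (rule surj_f_inv_f[OF orthogonal_transformation_surj[OF R]],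
        rule inv_f_f[OF orthogonal_transformation_inj[OF R]])
  have QR: "R (Q z + - Q v) + v = z" "Q (R z + v) + - Q v = z" for z
    by (simp_all add: RQ linear_diff[OF orthogonal_transformation_linear[OF R]]
        linear_add[OF orthogonal_transformation_linear[OF Q]])
  show ?thesis
    using le[OF R, where f = f and v = v and x = x and y = y]
      le[OF Q, where f = "\<lambda>x. f (R x + v)" and v = "- Q v" and x = "R x + v" and y = "R y + v"]
    unfolding QR by (intro antisym) simp_all
qed

section \<open>Concatenation of paths\<close>

text \<open>The path and its derivative are continuous only on parts of the unit interval, so both
  are extended by 0 before composition with \<open>f\<close>. Where this changes them, the integrand
  vanishes or is multiplied by 0.\<close>

lemma path_integrand_measurable:
  fixes \<gamma> :: "real \<Rightarrow> 'a::euclidean_space"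
  assumes [measurable]: "f \<in> borel_measurable borel"
    and "continuous_on {0..1} \<gamma>" "finite S" "continuous_on ({0..1} - S) D"
  shows "(\<lambda>t. ennreal (f (\<gamma> t) * norm (D t)) * indicator ({0..1} - S) t) \<in> borel_measurable borel"
proof -
  have S[measurable]: "S \<in> sets borel" using assms by (simp add: borel_closed finite_imp_closed)
  have [measurable]: "(\<lambda>t. indicator {0..1} t *\<^sub>R \<gamma> t) \<in> borel_measurable borel"
    using assms by (intro borel_measurable_continuous_on_indicator) auto
  have [measurable]: "(\<lambda>t. indicator ({0..1} - S) t *\<^sub>R D t) \<in> borel_measurable borel"
    using assms by (intro borel_measurable_continuous_on_indicator) auto
  have "(\<lambda>t. ennreal (f (\<gamma> t) * norm (D t)) * indicator ({0..1} - S) t)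
      = (\<lambda>t. ennreal (f (indicator {0..1} t *\<^sub>R \<gamma> t) * norm (indicator ({0..1} - S) t *\<^sub>R D t)))"
    by (auto simp: indicator_def fun_eq_iff)
  also have "\<dots> \<in> borel_measurable borel" by measurable
  finally show ?thesis .
qed

text \<open>On each half of the parameter interval the speed is doubled and the length of the
  interval is halved, so the two effects cancel. Measurability of \<open>f\<close> enters through
  additivity of the integral and the affine substitution.\<close>

lemma path_integral_join:
  fixes f :: "'a::euclidean_space \<Rightarrow> real"
  assumes f: "f \<in> borel_measurable borel"
    and \<gamma>: "valid_path \<gamma>1" "valid_path \<gamma>2"
  shows "path_integral f (\<gamma>1 +++ \<gamma>2) \<le> path_integral f \<gamma>1 + path_integral f \<gamma>2"
proof -
  obtain S1 D1 where S1: "finite S1" and D1: "\<And>t. t \<in> {0..1} - S1 \<Longrightarrow> (\<gamma>1 has_vector_derivative D1 t) (at t)"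
    and cont1: "continuous_on ({0..1} - S1) D1"
    using valid_path_derivativeE[OF \<gamma>(1)] by blast
  obtain S2 D2 where S2: "finite S2" and D2: "\<And>t. t \<in> {0..1} - S2 \<Longrightarrow> (\<gamma>2 has_vector_derivative D2 t) (at t)"
    and cont2: "continuous_on ({0..1} - S2) D2"
    using valid_path_derivativeE[OF \<gamma>(2)] by blast
  \<comment> \<open>The exceptional parameters of both paths, carried to their halves, together with
    the junction \<open>1/2\<close>.\<close>
  define S where "S = insert (1/2) ((\<lambda>t. t / 2) ` S1 \<union> (\<lambda>t. (t + 1) / 2) ` S2)"
  define D where "D t = (if t < 1/2 then 2 *\<^sub>R D1 (2 * t) else 2 *\<^sub>R D2 (2 * t - 1))" for t
  define h1 where "h1 t = ennreal (f (\<gamma>1 t) * norm (D1 t)) * indicator ({0..1} - S1) t" for t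
  define h2 where "h2 t = ennreal (f (\<gamma>2 t) * norm (D2 t)) * indicator ({0..1} - S2) t" for t
  have [measurable]: "h1 \<in> borel_measurable borel" "h2 \<in> borel_measurable borel"
    unfolding h1_def h2_def using \<gamma> S1 S2 cont1 cont2
    by (simp_all add: path_integrand_measurable[OF f] valid_path_def piecewise_C1_differentiable_on_def)
  have in1: "2 * t \<in> {0..1} - S1" if "t \<in> {0..1} - S" "t < 1/2" for t
  proof -
    have "2 * t \<notin> S1" using that(1) imageI[of "2 * t" S1 "\<lambda>t. t / 2"] by (auto simp: S_def)
    then show ?thesis using that by simp
  qed
  have in2: "2 * t - 1 \<in> {0..1} - S2" if "t \<in> {0..1} - S" "\<not> t < 1/2" for t
  proof -
    have "2 * t - 1 \<notin> S2" using that(1) imageI[of "2 * t - 1" S2 "\<lambda>t. (t + 1) / 2"] by (auto simp: S_def)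
    then show ?thesis using that by simp
  qed
  have D: "((\<gamma>1 +++ \<gamma>2) has_vector_derivative D t) (at t)" if t: "t \<in> {0..1} - S" for t
  proof (cases "t < 1/2")
    case True
    have "((\<gamma>1 \<circ> (\<lambda>t. 2 * t)) has_vector_derivative 2 *\<^sub>R D1 (2 * t)) (at t)"
      by (rule vector_diff_chain_at) (auto intro!: derivative_eq_intros D1 in1 t True)
    then have "((\<gamma>1 +++ \<gamma>2) has_vector_derivative 2 *\<^sub>R D1 (2 * t)) (at t)"
      by (rule has_vector_derivative_transform_within_open[where S = "{..<1/2}"])
         (use True in \<open>auto simp: joinpaths_def\<close>)
    then show ?thesis using True by (simp add: D_def)
  next
    case False
    then have "1/2 < t" using t by (auto simp: S_def)
    have "((\<gamma>2 \<circ> (\<lambda>t. 2 * t - 1)) has_vector_derivative 2 *\<^sub>R D2 (2 * t - 1)) (at t)"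
      by (rule vector_diff_chain_at) (auto intro!: derivative_eq_intros D2 in2 t False)
    then have "((\<gamma>1 +++ \<gamma>2) has_vector_derivative 2 *\<^sub>R D2 (2 * t - 1)) (at t)"
      by (rule has_vector_derivative_transform_within_open[where S = "{1/2<..}"])
         (use \<open>1/2 < t\<close> in \<open>auto simp: joinpaths_def\<close>)
    then show ?thesis using False by (simp add: D_def)
  qed
  have two: "ennreal (a * (2 * b)) = 2 * ennreal (a * b)" for a b :: real
    using ennreal_mult'[of 2 "a * b"] by (simp add: mult.left_commute)
  have "path_integral f (\<gamma>1 +++ \<gamma>2)
      = (\<integral>\<^sup>+ t. ennreal (f ((\<gamma>1 +++ \<gamma>2) t) * norm (D t)) * indicator ({0..1} - S) t \<partial>lborel)"
    by (rule path_integral_eq) (use S1 S2 D in \<open>auto simp: S_def\<close>)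
  \<comment> \<open>As \<open>h1\<close> and \<open>h2\<close> vanish outside the unit interval, the
    two terms can overlap only at \<open>t = 1/2\<close>. The factors 2 come from the doubled
    speed.\<close>
  also have "\<dots> \<le> (\<integral>\<^sup>+ t. 2 * h1 (0 + 2 * t) + 2 * h2 (- 1 + 2 * t) \<partial>lborel)"
  proof (rule nn_integral_mono)
    fix t :: real
    show "ennreal (f ((\<gamma>1 +++ \<gamma>2) t) * norm (D t)) * indicator ({0..1} - S) t
        \<le> 2 * h1 (0 + 2 * t) + 2 * h2 (- 1 + 2 * t)"
    proof (cases "t \<in> {0..1} - S")
      case t: True
      show ?thesis
      proof (cases "t < 1/2")
        case True
        then have "ennreal (f ((\<gamma>1 +++ \<gamma>2) t) * norm (D t)) * indicator ({0..1} - S) t = 2 * h1 (0 + 2 * t)"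
          using t in1[OF t True] by (simp add: D_def h1_def joinpaths_def two)
        then show ?thesis by simp
      next
        case False
        then have "t > 1/2" using t by (auto simp: S_def)
        then have "ennreal (f ((\<gamma>1 +++ \<gamma>2) t) * norm (D t)) * indicator ({0..1} - S) t = 2 * h2 (- 1 + 2 * t)"
          using t in2[OF t False] by (simp add: D_def h2_def joinpaths_def two)
        then show ?thesis by simp
      qed
    qed simp
  qed
  also have "\<dots> = 2 * (\<integral>\<^sup>+ t. h1 (0 + 2 * t) \<partial>lborel) + 2 * (\<integral>\<^sup>+ t. h2 (- 1 + 2 * t) \<partial>lborel)"
    by (simp add: nn_integral_add nn_integral_cmult)
  also have "\<dots> = (\<integral>\<^sup>+ t. h1 t \<partial>lborel) + (\<integral>\<^sup>+ t. h2 t \<partial>lborel)"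
    using nn_integral_real_affine[of h1 2 0] nn_integral_real_affine[of h2 2 "-1"] by simp
  also have "\<dots> = path_integral f \<gamma>1 + path_integral f \<gamma>2"
    using path_integral_eq[OF S1 D1, of f] path_integral_eq[OF S2 D2, of f] by (simp add: h1_def h2_def)
  finally show ?thesis .
qed

text \<open>Adding a constant is monotone and continuous on the extended half-line, infinity
  included.\<close>

lemma INF_ennreal_add_right:
  fixes f :: "'b \<Rightarrow> ennreal"
  assumes "I \<noteq> {}"
  shows "(INF i\<in>I. f i + c) = (INF i\<in>I. f i) + c"
proof -
  have "Inf (f ` I) + c = (INF s\<in>f ` I. s + c)"
  proof (rule continuous_at_Inf_mono)
    show "continuous (at_right (Inf (f ` I))) (\<lambda>x. x + c)"
      by (intro continuous_add continuous_ident continuous_const)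
  qed (use assms in \<open>auto simp: mono_def add_right_mono\<close>)
  then show ?thesis by (simp add: image_comp)
qed

lemma INF_ennreal_add_left:
  fixes f :: "'b \<Rightarrow> ennreal"
  assumes "I \<noteq> {}"
  shows "(INF i\<in>I. c + f i) = c + (INF i\<in>I. f i)"
  using INF_ennreal_add_right[OF assms, of f c] by (simp add: add.commute)

lemma pseudometric_triangle:
  fixes f :: "'a::euclidean_space \<Rightarrow> real"
  assumes f: "f \<in> borel_measurable borel"
  shows "pseudometric f x z \<le> pseudometric f x y + pseudometric f y z"
proof -
  define I where "I x y = {\<gamma> :: real \<Rightarrow> 'a. valid_path \<gamma> \<and> pathstart \<gamma> = x \<and> pathfinish \<gamma> = y}" for x y
  have "linepath x y \<in> I x y" for x y by (simp add: I_def)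
  then have ne: "I x y \<noteq> {}" for x y by blast
  have "pseudometric f x z \<le> path_integral f \<gamma>1 + path_integral f \<gamma>2"
    if "\<gamma>1 \<in> I x y" "\<gamma>2 \<in> I y z" for \<gamma>1 \<gamma>2
  proof -
    have "pseudometric f x z \<le> path_integral f (\<gamma>1 +++ \<gamma>2)"
      unfolding pseudometric_def using that by (intro INF_lower) (auto simp: I_def intro!: valid_path_join)
    also have "\<dots> \<le> path_integral f \<gamma>1 + path_integral f \<gamma>2"
      using that by (intro path_integral_join f) (auto simp: I_def)
    finally show ?thesis .
  qed
  then have "pseudometric f x z \<le> (INF \<gamma>1\<in>I x y. INF \<gamma>2\<in>I y z. path_integral f \<gamma>1 + path_integral f \<gamma>2)"
    by (intro INF_greatest)
  also have "\<dots> = pseudometric f x y + pseudometric f y z"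
    using ne unfolding pseudometric_def I_def[symmetric]
    by (simp add: INF_ennreal_add_left INF_ennreal_add_right)
  finally show ?thesis .
qed

subsection \<open>The time constant\<close>

lemma pseudometric_translate:
  "pseudometric (translate v f) x y = pseudometric f (x + v) (y + v)"
  unfolding translate_def by (rule pseudometric_isometry[OF orthogonal_transformation_id])

lemma pseudometric_comp_orthogonal:
  fixes f :: "'a::euclidean_space \<Rightarrow> real" and R :: "'a \<Rightarrow> 'a"
  assumes "orthogonal_transformation R"
  shows "pseudometric (f \<circ> R) x y = pseudometric f (R x) (R y)"
  using pseudometric_isometry[OF assms, where v = 0 and f = f] by (simp add: o_def)

lemma translate_funpow: "(translate v ^^ n) = translate (real n *\<^sub>R v)"
proof (induction n)
  case 0
  show ?case by (simp add: translate_def fun_eq_iff)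
next
  case (Suc n)
  then show ?case by (simp add: translate_def fun_eq_iff algebra_simps)
qed

section \<open>Directional limits and their regularity\<close>

locale ergodic_lipschitz_density =
  fixes M :: "'w measure" and N :: "('a::euclidean_space \<Rightarrow> real) measure"
    and \<sigma> :: "'w \<Rightarrow> 'a \<Rightarrow> real" and C :: real
  assumes density: "random_density M N \<sigma>"
    and meas: "AE \<omega> in M. \<sigma> \<omega> \<in> borel_measurable borel"
    and ergodic: "\<And>v. v \<noteq> 0 \<Longrightarrow> ergodic_for (distr M N \<sigma>) (translate v)"
    and C: "0 < C"
    and lipschitz: "AE \<omega> in M. \<forall>x y. pseudometric (\<sigma> \<omega>) x y \<le> ennreal (C * dist x y)"
begin

sublocale prob_space M
  using density by (simp add: random_density_def)

lemma sigma_measurable [measurable]: "\<sigma> \<in> M \<rightarrow>\<^sub>M N"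
  using density by (simp add: random_density_def)

lemma pseudometric_measurable [measurable]: "(\<lambda>f. pseudometric f x y) \<in> borel_measurable N"
  using density by (simp add: random_density_def)

text \<open>An infinite distance would become 0 here; by \<open>AE_regular\<close> this happens only
  on a null set.\<close>

definition T :: "'w \<Rightarrow> 'a \<Rightarrow> real" where
  "T \<omega> x = enn2real (pseudometric (\<sigma> \<omega>) 0 x)"

lemma T_measurable [measurable]: "(\<lambda>\<omega>. T \<omega> x) \<in> borel_measurable M"
  unfolding T_def by (rule measurable_compose[OF sigma_measurable]) measurable

text \<open>The triangle inequality, available when the density is measurable, turns the bound on
  distances into a Lipschitz bound for \<open>T\<close>. The exceptional null set is common to all
  points.\<close>

lemma AE_regular:
  "AE \<omega> in M. (\<forall>x. pseudometric (\<sigma> \<omega>) 0 x = ennreal (T \<omega> x)) \<and> T \<omega> 0 = 0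
     \<and> (\<forall>x y. \<bar>T \<omega> x - T \<omega> y\<bar> \<le> C * dist x y)"
  using meas lipschitz
proof eventually_elim
  case (elim \<omega>)
  have fin: "pseudometric (\<sigma> \<omega>) x y < top" for x y
    using elim(2) by (meson ennreal_less_top order_le_less_trans)
  have eq: "pseudometric (\<sigma> \<omega>) 0 x = ennreal (T \<omega> x)" for x
    using fin by (simp add: T_def)
  have "T \<omega> x \<le> T \<omega> y + C * dist x y" for x y
  proof -
    have "ennreal (T \<omega> x) \<le> ennreal (T \<omega> y) + ennreal (C * dist x y)"
      unfolding eq[symmetric]
      using pseudometric_triangle[OF elim(1), of 0 x y] elim(2)
      by (metis add_left_mono dist_commute order_trans)
    then show ?thesis
      using C by (simp add: T_def flip: ennreal_plus)
  qed
  then have "\<bar>T \<omega> x - T \<omega> y\<bar> \<le> C * dist x y" for x y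
    by (smt (verit) dist_commute)
  moreover have "T \<omega> 0 = 0"
    using elim(2)[rule_format, of 0 0] by (simp add: T_def)
  ultimately show ?case using eq by blast
qed

text \<open>The ergodic theorem is applied on the space of densities, with translation by
  \<open>v\<close> as the transformation. It asks for its inequalities at every density, while the
  Lipschitz bound and the triangle inequality hold only almost surely; hence \<open>F\<close> is set
  to 0 outside an invariant set \<open>G\<close> of full probability.\<close>

lemma directional_limit_nonzero:
  assumes v: "v \<noteq> 0"
  shows "\<exists>m. AE \<omega> in M. (\<lambda>n. T \<omega> (real n *\<^sub>R v) / real n) \<longlonglongrightarrow> m"
proof -
  \<comment> \<open>Only integer multiples of \<open>v\<close> are used, so that \<open>G\<close> is
    cut out by countably many measurable conditions.\<close>
  define a where "a f i j = pseudometric f (of_int i *\<^sub>R v) (of_int j *\<^sub>R v)" for f and i j :: int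
  have [measurable]: "(\<lambda>f. a f i j) \<in> borel_measurable N" for i j
    unfolding a_def by measurable
  have a_translate: "a (translate v f) i j = a f (i + 1) (j + 1)" for f i j
    by (simp add: a_def pseudometric_translate algebra_simps)
  \<comment> \<open>The good densities are cut out by conditions on the whole two-sided orbit, so that this set
    is invariant exactly and not only up to null sets.\<close>
  define G where "G = {f \<in> space N. \<forall>i j k. a f i j \<le> ennreal (C * norm v * \<bar>of_int i - of_int j\<bar>)
    \<and> a f i k \<le> a f i j + a f j k}"
  have [measurable]: "Measurable.pred N (\<lambda>f. a f i k \<le> a f i j + a f j k)" for i j k
    unfolding pred_def by (intro borel_measurable_le borel_measurable_add) measurable
  have G_sets[measurable]: "G \<in> sets N" unfolding G_def by measurable
  define P where "P = distr M N \<sigma>"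
  have P: "prob_space P" unfolding P_def by (rule prob_space_distr) measurable
  have sets_P[measurable_cong]: "sets P = sets N" and space_P: "space P = space N"
    by (simp_all add: P_def)
  \<comment> \<open>A power of the translation is the translation by \<open>k\<close> times
    \<open>v\<close>, again a nonzero vector, so the hypothesis covers it.\<close>
  have erg: "ergodic_for P (translate v ^^ k)" if "k \<ge> 1" for k
    unfolding translate_funpow P_def using that v by (intro ergodic) auto
  have "translate v \<in> P \<rightarrow>\<^sub>M P"
    using erg[of 1] by (simp add: ergodic_for_def law_invariant_def)
  then have maps: "translate v f \<in> space N" if "f \<in> space N" for f
    using that measurable_space[of "translate v" P P f] by (simp add: space_P)
  have G_invariant: "translate v f \<in> G \<longleftrightarrow> f \<in> G" if "f \<in> space N" for f
  proof -
    let ?good = "\<lambda>i j k. a f i j \<le> ennreal (C * norm v * \<bar>of_int i - of_int j\<bar>)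
      \<and> a f i k \<le> a f i j + a f j k"
    have "translate v f \<in> G \<longleftrightarrow> (\<forall>i j k. ?good (i + 1) (j + 1) (k + 1))"
      using maps[OF that] by (simp add: G_def a_translate)
    \<comment> \<open>The shift by 1 is a bijection of the integers; with natural indices only one
      implication would survive.\<close>
    also have "\<dots> \<longleftrightarrow> (\<forall>i j k. ?good i j k)" by (metis diff_add_cancel)
    finally show ?thesis using that by (simp add: G_def)
  qed
  have iterate: "(translate v ^^ m) f \<in> space N \<and> ((translate v ^^ m) f \<in> G \<longleftrightarrow> f \<in> G)
      \<and> (\<forall>i j. a ((translate v ^^ m) f) i j = a f (i + int m) (j + int m))"
    if "f \<in> space N" for f m
    using that by (induction m) (auto simp: maps G_invariant a_translate algebra_simps)
  have AE_G: "AE f in P. f \<in> G"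
    unfolding P_def
  proof (subst AE_distr_iff)
    show "AE \<omega> in M. \<sigma> \<omega> \<in> G"
      using meas lipschitz AE_space
    proof eventually_elim
      case (elim \<omega>)
      have "dist (of_int i *\<^sub>R v) (of_int j *\<^sub>R v) = norm v * \<bar>of_int i - of_int j\<bar>" for i j
        by (simp add: dist_norm mult.commute flip: scaleR_left_diff_distrib)
      then have "a (\<sigma> \<omega>) i j \<le> ennreal (C * norm v * \<bar>of_int i - of_int j\<bar>)" for i j
        using elim(2) by (metis a_def mult.assoc)
      then show ?case
        using pseudometric_triangle[OF elim(1)] measurable_space[OF sigma_measurable elim(3)]
        by (simp add: G_def a_def)
    qed
  qed measurable
  define r where "r f i j = enn2real (a f i j)" for f i j
  have r_upper: "r f i j \<le> C * norm v * \<bar>of_int i - of_int j\<bar>" if "f \<in> G" for f i j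
    using that C unfolding r_def G_def by (intro enn2real_leI) auto
  have r_triangle: "r f i k \<le> r f i j + r f j k" if "f \<in> G" for f i j k
  proof -
    have fin: "a f i j < top" for i j
      using that by (auto simp: G_def intro: order_le_less_trans[OF _ ennreal_less_top])
    have "r f i k \<le> enn2real (a f i j + a f j k)"
      unfolding r_def using that fin by (intro enn2real_mono) (auto simp: G_def)
    then show ?thesis using fin by (simp add: r_def enn2real_plus)
  qed
  define F where "F n f = (if f \<in> G then r f 0 (int n) else 0)" for n f
  have "\<exists>c. AE f in P. (\<lambda>n. F n f / real n) \<longlonglongrightarrow> c"
  proof (rule subadditive_ergodic[OF P erg, where C = "C * norm v" and D = "C * norm v"])
    show "F n \<in> borel_measurable P" for n
      unfolding F_def r_def by measurable
    fix n f assume "f \<in> space P"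
    then have f: "f \<in> space N" by (simp add: space_P)
    show "0 \<le> F n f" by (simp add: F_def r_def)
    show "F n f \<le> C * norm v * real n"
      using r_upper[of f 0 "int n"] C by (simp add: F_def)
    show "F (m + n) f \<le> F m f + F n ((translate v ^^ m) f)" for m
      using r_triangle[of f 0 "int (m + n)" "int m"] iterate[OF f, of m]
      by (auto simp: F_def r_def add.commute)
    have "0 \<le> C * norm v" using C by simp
    \<comment> \<open>The distance from \<open>v\<close> to \<open>(n + 1) v\<close> is at most the
      distance from \<open>v\<close> to 0, which is bounded by \<open>C * norm v\<close>, plus the
      distance from 0 to \<open>(n + 1) v\<close>.\<close>
    then show "F n (translate v f) \<le> C * norm v + F (Suc n) f"
      using r_triangle[of f 1 "1 + int n" 0] r_upper[of f 1 0] G_invariant[OF f]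
      by (auto simp: F_def r_def a_translate add.commute)
  qed
  then obtain c where "AE f in P. (\<lambda>n. F n f / real n) \<longlonglongrightarrow> c" by blast
  with AE_G have "AE f in P. (\<lambda>n. enn2real (pseudometric f 0 (real n *\<^sub>R v)) / real n) \<longlonglongrightarrow> c"
    by eventually_elim (simp add: F_def r_def a_def)
  then show ?thesis
    unfolding P_def T_def by (intro exI) (rule AE_distrD[OF sigma_measurable])
qed

lemma directional_limit:
  "\<exists>m. AE \<omega> in M. (\<lambda>n. T \<omega> (real n *\<^sub>R v) / real n) \<longlonglongrightarrow> m"
proof (cases "v = 0")
  case True
  have "AE \<omega> in M. (\<lambda>n. T \<omega> (real n *\<^sub>R v) / real n) \<longlonglongrightarrow> 0"
    using AE_regular by eventually_elim (simp add: True)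
  then show ?thesis by blast
qed (rule directional_limit_nonzero)

text \<open>The Lipschitz bound dominates the quotients by a constant, so almost sure convergence
  also gives convergence of the means. Almost sure limits are unique on a probability space, which
  evaluates the \<open>THE\<close> in \<open>time_constant\<close>.\<close>

lemma AE_time_constant:
  "AE \<omega> in M. (\<lambda>n. T \<omega> (real n *\<^sub>R v) / real n) \<longlonglongrightarrow> time_constant M \<sigma> v"
proof -
  obtain m where m: "AE \<omega> in M. (\<lambda>n. T \<omega> (real n *\<^sub>R v) / real n) \<longlonglongrightarrow> m"
    using directional_limit by blast
  have "(\<lambda>n. \<integral>\<^sup>+ \<omega>. ennreal \<bar>T \<omega> (real n *\<^sub>R v) / real n - m\<bar> \<partial>M) \<longlonglongrightarrow> (\<integral>\<^sup>+ \<omega>. 0 \<partial>M)"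
  proof (rule nn_integral_dominated_convergence[where w = "\<lambda>_. ennreal (C * norm v + \<bar>m\<bar>)"])
    show "AE \<omega> in M. (\<lambda>n. ennreal \<bar>T \<omega> (real n *\<^sub>R v) / real n - m\<bar>) \<longlonglongrightarrow> 0"
      using m
    proof eventually_elim
      case (elim \<omega>)
      then have "(\<lambda>n. \<bar>T \<omega> (real n *\<^sub>R v) / real n - m\<bar>) \<longlonglongrightarrow> 0"
        by (simp add: LIM_zero tendsto_rabs_zero)
      then show ?case by (simp add: tendsto_ennrealI flip: ennreal_0)
    qed
    show "AE \<omega> in M. ennreal \<bar>T \<omega> (real n *\<^sub>R v) / real n - m\<bar> \<le> ennreal (C * norm v + \<bar>m\<bar>)" for n
      using AE_regular
    proof eventually_elim
      case (elim \<omega>)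
      then have "\<bar>T \<omega> (real n *\<^sub>R v) - T \<omega> 0\<bar> \<le> C * dist (real n *\<^sub>R v) 0" by blast
      then have "\<bar>T \<omega> (real n *\<^sub>R v)\<bar> \<le> C * norm v * real n"
        using elim by (simp add: ac_simps)
      then have "\<bar>T \<omega> (real n *\<^sub>R v) / real n\<bar> \<le> C * norm v"
        using C by (cases "n = 0") (simp_all add: field_simps)
      then show ?case by (intro ennreal_leI) linarith
    qed
  qed (auto simp: emeasure_space_1)
  with m have "is_time_constant M \<sigma> v m"
    by (simp add: is_time_constant_def T_def)
  moreover have "m' = m" if "is_time_constant M \<sigma> v m'" for m'
  proof -
    have "AE \<omega> in M. (\<lambda>n. T \<omega> (real n *\<^sub>R v) / real n) \<longlonglongrightarrow> m'"
      using that by (simp add: is_time_constant_def T_def)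
    with m have "AE \<omega> in M. m' = m" by eventually_elim (rule LIMSEQ_unique)
    then show ?thesis by simp
  qed
  ultimately have "time_constant M \<sigma> v = m"
    unfolding time_constant_def by (intro the_equality)
  then show ?thesis using m by simp
qed

text \<open>The bound for \<open>T\<close> is homogeneous in \<open>n\<close> and passes to the
  limit. Being deterministic, the resulting statement holds once it holds almost surely.\<close>

lemma time_constant_lipschitz:
  "\<bar>time_constant M \<sigma> x - time_constant M \<sigma> y\<bar> \<le> C * dist x y"
proof -
  have "AE \<omega> in M. \<bar>time_constant M \<sigma> x - time_constant M \<sigma> y\<bar> \<le> C * dist x y"
    using AE_regular AE_time_constant[of x] AE_time_constant[of y]
  proof eventually_elim
    case (elim \<omega>)
    have "\<bar>T \<omega> (real n *\<^sub>R x) / real n - T \<omega> (real n *\<^sub>R y) / real n\<bar> \<le> C * dist x y" if "n \<ge> 1" for n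
    proof -
      have "\<bar>T \<omega> (real n *\<^sub>R x) - T \<omega> (real n *\<^sub>R y)\<bar> \<le> C * dist (real n *\<^sub>R x) (real n *\<^sub>R y)"
        using elim(1) by blast
      also have "dist (real n *\<^sub>R x) (real n *\<^sub>R y) = real n * dist x y"
        by (simp add: dist_norm flip: scaleR_right_diff_distrib)
      finally show ?thesis
        using that by (simp add: field_simps flip: diff_divide_distrib)
    qed
    moreover have "(\<lambda>n. \<bar>T \<omega> (real n *\<^sub>R x) / real n - T \<omega> (real n *\<^sub>R y) / real n\<bar>)
        \<longlonglongrightarrow> \<bar>time_constant M \<sigma> x - time_constant M \<sigma> y\<bar>"
      by (intro tendsto_intros elim)
    ultimately show ?case by (intro LIMSEQ_le_const2) auto
  qed
  then show ?thesis by simp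
qed

text \<open>Distances for \<open>f \<circ> R\<close> in direction \<open>v\<close> are distances for
  \<open>f\<close> in direction \<open>R v\<close>. As both densities have the same law, the limits
  in the two directions agree.\<close>

lemma time_constant_orthogonal:
  assumes R: "orthogonal_transformation R"
    and inv: "law_invariant (distr M N \<sigma>) (\<lambda>f. f \<circ> R)"
  shows "time_constant M \<sigma> (R v) = time_constant M \<sigma> v"
proof -
  let ?P = "distr M N \<sigma>"
  define Q where "Q w m f \<longleftrightarrow> (\<lambda>n. enn2real (pseudometric f 0 (real n *\<^sub>R w)) / real n) \<longlonglongrightarrow> m"
    for w m and f :: "'a \<Rightarrow> real"
  have Q_sets: "{f \<in> space N. Q w m f} \<in> sets N" for w m
    unfolding Q_def by measurable
  have Q: "AE f in ?P. Q w (time_constant M \<sigma> w) f" for w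
    using AE_time_constant[of w] by (subst AE_distr_iff[OF sigma_measurable Q_sets]) (simp add: Q_def T_def)
  have "distr ?P ?P (\<lambda>f. f \<circ> R) = ?P" using inv unfolding law_invariant_def by blast
  then have "AE f in distr ?P ?P (\<lambda>f. f \<circ> R). Q v (time_constant M \<sigma> v) f" using Q by metis
  then have "AE f in ?P. Q v (time_constant M \<sigma> v) (f \<circ> R)"
    using inv by (intro AE_distrD[of "\<lambda>f. f \<circ> R" ?P ?P]) (simp_all add: law_invariant_def)
  moreover have "R (real n *\<^sub>R v) = real n *\<^sub>R R v" "R 0 = 0" for n
    using orthogonal_transformation_linear[OF R] by (simp_all add: linear_cmul linear_0)
  ultimately have "AE f in ?P. Q (R v) (time_constant M \<sigma> v) f"
    by (simp add: Q_def pseudometric_comp_orthogonal[OF R])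
  with Q[of "R v"] have "AE f in ?P. time_constant M \<sigma> (R v) = time_constant M \<sigma> v"
    unfolding Q_def by eventually_elim (rule LIMSEQ_unique)
  then have "AE \<omega> in M. time_constant M \<sigma> (R v) = time_constant M \<sigma> v"
    by (rule AE_distrD[OF sigma_measurable])
  then show ?thesis by simp
qed

end

subsection \<open>The limit shape\<close>

text \<open>A far point \<open>x\<close> is compared with \<open>n *\<^sub>R s\<close>, where
  \<open>n\<close> is the integer part of \<open>norm x\<close> and \<open>s\<close> a net point
  near the direction of \<open>x\<close>. Moving between them costs at most
  \<open>C * (1 + \<delta> * norm x)\<close> for \<open>T\<close> and again for
  \<open>\<mu>\<close>, and convergence along \<open>s\<close> costs
  \<open>\<delta> * norm x\<close>. This explains the factor \<open>2 * C + 1\<close>;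
  \<open>A\<close> absorbs the rest and the bounded region where convergence has not yet set
  in.\<close>

lemma sublinear_approximation:
  fixes T \<mu> :: "'a::euclidean_space \<Rightarrow> real"
  assumes C: "0 < C" and \<eta>: "0 < \<eta>"
    and T: "T 0 = 0" "\<And>x y. \<bar>T x - T y\<bar> \<le> C * dist x y"
    and \<mu>: "\<And>a x. 0 \<le> a \<Longrightarrow> \<mu> (a *\<^sub>R x) = a * \<mu> x" "\<And>x y. \<bar>\<mu> x - \<mu> y\<bar> \<le> C * dist x y"
    and net: "finite S" "sphere 0 1 \<subseteq> (\<Union>s\<in>S. ball s \<delta>)" "(2 * C + 1) * \<delta> = \<eta>"
    and lim: "\<And>s. s \<in> S \<Longrightarrow> (\<lambda>n. T (real n *\<^sub>R s) / real n) \<longlonglongrightarrow> \<mu> s"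
  shows "\<exists>A. \<forall>x. \<bar>T x - \<mu> x\<bar> \<le> A + \<eta> * norm x"
proof -
  have \<delta>: "0 < \<delta>" using net(3) \<eta> C by (metis add_pos_pos mult_pos_pos zero_less_mult_pos zero_less_numeral zero_less_one)
  have "\<forall>\<^sub>F n in sequentially. \<forall>s\<in>S. \<bar>T (real n *\<^sub>R s) / real n - \<mu> s\<bar> < \<delta>"
    using tendstoD[OF lim \<delta>] by (intro eventually_ball_finite net) (simp add: dist_real_def)
  then obtain n0 where n0: "\<And>n s. n \<ge> n0 \<Longrightarrow> s \<in> S \<Longrightarrow> \<bar>T (real n *\<^sub>R s) / real n - \<mu> s\<bar> < \<delta>"
    by (auto simp: eventually_sequentially)
  have "\<bar>T x - \<mu> x\<bar> \<le> 2 * C * (real n0 + 1) + \<eta> * norm x" for x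
  proof (cases "norm x < real n0 + 1")
    case True
    have "\<bar>T x - \<mu> x\<bar> \<le> 2 * C * norm x"
      using T(1) T(2)[of x 0] \<mu>(1)[of 0 0] \<mu>(2)[of x 0] by simp
    also have "\<dots> \<le> 2 * C * (real n0 + 1)" using True C by simp
    finally show ?thesis using \<eta> by (smt (verit) mult_nonneg_nonneg norm_ge_zero)
  next
    case False
    define n where "n = nat \<lfloor>norm x\<rfloor>"
    have n: "real n \<le> norm x" "norm x \<le> real n + 1" "n \<ge> n0" "n \<ge> 1"
      using False unfolding n_def by linarith+
    define u where "u = x /\<^sub>R norm x"
    have x: "x \<noteq> 0" using False by auto
    then have "u \<in> sphere 0 1" by (simp add: u_def)
    then obtain s where s: "s \<in> S" "dist s u < \<delta>" using net(2) by auto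
    have "dist x (real n *\<^sub>R s) \<le> dist x (real n *\<^sub>R u) + dist (real n *\<^sub>R u) (real n *\<^sub>R s)"
      by (rule dist_triangle)
    also have "x = norm x *\<^sub>R u" using x by (simp add: u_def)
    then have "dist x (real n *\<^sub>R u) = \<bar>norm x - real n\<bar> * norm u"
      by (metis dist_norm norm_scaleR scaleR_left_diff_distrib)
    then have "dist x (real n *\<^sub>R u) \<le> 1" using n x by (simp add: u_def)
    also have "dist (real n *\<^sub>R u) (real n *\<^sub>R s) = real n * dist s u"
      by (simp add: dist_norm norm_minus_commute flip: scaleR_right_diff_distrib)
    also have "\<dots> \<le> norm x * \<delta>" using n s \<delta> by (intro mult_mono) auto
    finally have "C * dist x (real n *\<^sub>R s) \<le> C * (1 + norm x * \<delta>)" using C by simp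
    then have "\<bar>T x - T (real n *\<^sub>R s)\<bar> \<le> C * (1 + norm x * \<delta>)"
      "\<bar>\<mu> x - \<mu> (real n *\<^sub>R s)\<bar> \<le> C * (1 + norm x * \<delta>)"
      using T(2) \<mu>(2) order_trans by blast+
    moreover have "\<bar>T (real n *\<^sub>R s) - \<mu> (real n *\<^sub>R s)\<bar> \<le> norm x * \<delta>"
    proof -
      have "T (real n *\<^sub>R s) - \<mu> (real n *\<^sub>R s) = real n * (T (real n *\<^sub>R s) / real n - \<mu> s)"
        using n by (simp add: \<mu> field_simps)
      then have "\<bar>T (real n *\<^sub>R s) - \<mu> (real n *\<^sub>R s)\<bar> = real n * \<bar>T (real n *\<^sub>R s) / real n - \<mu> s\<bar>"
        by (simp add: abs_mult)
      also have "\<dots> \<le> norm x * \<delta>"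
        using n n0[OF n(3) s(1)] by (intro mult_mono) auto
      finally show ?thesis .
    qed
    ultimately have "\<bar>T x - \<mu> x\<bar> \<le> 2 * (C * (1 + norm x * \<delta>)) + norm x * \<delta>" by linarith
    also have "\<dots> = 2 * C + ((2 * C + 1) * \<delta>) * norm x" by (simp add: algebra_simps)
    also have "\<dots> \<le> 2 * C * (real n0 + 1) + \<eta> * norm x" using C net(3) by (simp add: algebra_simps)
    finally show ?thesis .
  qed
  then show ?thesis by blast
qed

text \<open>Homogeneity is an assumption because each case of the theorem supplies it:
  \<open>\<mu>\<close> is zero or a norm. The net is finite by compactness of the sphere, so one
  null set suffices for a given \<open>\<eta>\<close>.\<close>

lemma (in ergodic_lipschitz_density) AE_sublinear_approximation:
  assumes hom: "\<And>a x. 0 \<le> a \<Longrightarrow> time_constant M \<sigma> (a *\<^sub>R x) = a * time_constant M \<sigma> x"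
    and \<eta>: "0 < \<eta>"
  shows "AE \<omega> in M. \<exists>A. \<forall>x. \<bar>T \<omega> x - time_constant M \<sigma> x\<bar> \<le> A + \<eta> * norm x"
proof -
  define \<delta> where "\<delta> = \<eta> / (2 * C + 1)"
  have \<delta>: "0 < \<delta>" using \<eta> C by (simp add: \<delta>_def)
  have eq: "(2 * C + 1) * \<delta> = \<eta>" using C by (simp add: \<delta>_def)
  obtain S where S: "finite S" "sphere (0::'a) 1 \<subseteq> (\<Union>s\<in>S. ball s \<delta>)"
    using compactE_image[of "sphere (0::'a) 1" "sphere 0 1" "\<lambda>s. ball s \<delta>"] \<delta>
    by (metis (no_types, lifting) UN_I centre_in_ball compact_sphere open_ball subsetI)
  have "AE \<omega> in M. \<forall>s\<in>S. (\<lambda>n. T \<omega> (real n *\<^sub>R s) / real n) \<longlonglongrightarrow> time_constant M \<sigma> s"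
    using AE_time_constant by (intro AE_finite_allI S)
  with AE_regular show ?thesis
  proof eventually_elim
    case (elim \<omega>)
    show ?case
      by (rule sublinear_approximation[OF C \<eta> _ _ hom time_constant_lipschitz S eq]) (use elim in auto)
  qed
qed

lemma mem_dilate_iff:
  assumes "c \<noteq> 0"
  shows "x \<in> dilate c S \<longleftrightarrow> (1 / c) *\<^sub>R x \<in> S"
proof
  assume "(1 / c) *\<^sub>R x \<in> S"
  then show "x \<in> dilate c S"
    using assms unfolding dilate_def by (intro image_eqI[of _ _ "(1 / c) *\<^sub>R x"]) simp_all
qed (use assms in \<open>auto simp: dilate_def\<close>)

text \<open>With slope \<open>1 / (2 * r)\<close>, a point of norm at most \<open>r * t\<close> has
  \<open>T\<close> at most \<open>A + t / 2\<close>, and this is at most \<open>t\<close> once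
  \<open>t \<ge> 2 * A\<close>.\<close>

lemma sublinear_ball_inclusion:
  fixes T :: "'a::euclidean_space \<Rightarrow> real"
  assumes r: "0 < r" and T: "\<And>x. \<bar>T x\<bar> \<le> A + 1 / (2 * r) * norm x"
  shows "eventually (\<lambda>t. dilate r (cball 0 1) \<subseteq> dilate (1 / t) {x. T x \<le> t}) at_top"
  using eventually_ge_at_top[of "max 1 (2 * A)"]
proof eventually_elim
  case (elim t)
  show ?case
  proof
    fix x :: 'a assume "x \<in> dilate r (cball 0 1)"
    then have "norm x \<le> r" using r by (auto simp: dilate_def)
    then have "1 / (2 * r) * norm (t *\<^sub>R x) \<le> t / 2"
      using r elim by (simp add: field_simps)
    then have "T (t *\<^sub>R x) \<le> t" using T[of "t *\<^sub>R x"] elim by linarith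
    then show "x \<in> dilate (1 / t) {x. T x \<le> t}" using elim by (simp add: mem_dilate_iff)
  qed
qed

text \<open>The lower bound \<open>a * norm x \<le> \<mu> x\<close> turns the error into a relative
  one, \<open>A + \<kappa> * \<mu> x\<close>, and \<open>A \<le> \<epsilon> / 2 * t\<close> for
  large \<open>t\<close>. The value of \<open>\<kappa>\<close> is the solution of
  \<open>(1 - \<kappa>) * (1 + \<epsilon>) = 1 + \<epsilon> / 2\<close>, which is what the outer
  inclusion requires. The inner one follows from \<open>\<kappa> \<le> \<epsilon> / 2\<close>; it is
  restricted to \<open>\<epsilon> \<le> 1\<close> because \<open>hom\<close> concerns nonnegative
  factors only.\<close>

lemma shape_inclusions:
  fixes T \<mu> :: "'a::euclidean_space \<Rightarrow> real"
  assumes \<epsilon>: "0 < \<epsilon>" and hom: "\<And>a x. 0 \<le> a \<Longrightarrow> \<mu> (a *\<^sub>R x) = a * \<mu> x"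
    and a: "0 < a" "\<And>x. a * norm x \<le> \<mu> x"
    and T: "\<And>x. \<bar>T x - \<mu> x\<bar> \<le> A + (\<epsilon> / (2 * (1 + \<epsilon>)) * a) * norm x"
  shows "eventually (\<lambda>t. (\<epsilon> \<le> 1 \<longrightarrow> dilate (1 - \<epsilon>) {x. \<mu> x \<le> 1} \<subseteq> dilate (1 / t) {x. T x \<le> t})
     \<and> dilate (1 / t) {x. T x \<le> t} \<subseteq> dilate (1 + \<epsilon>) {x. \<mu> x \<le> 1}) at_top"
  using eventually_ge_at_top[of "max 1 (2 * \<bar>A\<bar> / \<epsilon>)"]
proof eventually_elim
  case (elim t)
  define \<kappa> where "\<kappa> = \<epsilon> / (2 * (1 + \<epsilon>))"
  have t: "t \<ge> 1" "A \<le> \<epsilon> / 2 * t" using elim \<epsilon> by (auto simp: field_simps)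
  have \<kappa>: "0 < \<kappa>" "\<kappa> \<le> \<epsilon> / 2" "(1 - \<kappa>) * (1 + \<epsilon>) = 1 + \<epsilon> / 2"
    using \<epsilon> by (auto simp: \<kappa>_def field_simps)
  have \<kappa>1: "0 < 1 - \<kappa>"
    by (rule zero_less_mult_pos2[of _ "1 + \<epsilon>"]) (use \<kappa>(3) \<epsilon> in auto)
  have approx: "\<bar>T z - \<mu> z\<bar> \<le> A + \<kappa> * \<mu> z" for z
    using T[of z] mult_left_mono[OF a(2)[of z], of \<kappa>] \<kappa> by (simp add: \<kappa>_def mult.assoc)
  have \<mu>0: "0 \<le> \<mu> z" for z using a by (meson less_imp_le mult_nonneg_nonneg norm_ge_zero order_trans)
  show ?case
  proof (intro conjI impI subsetI)
    fix x assume "\<epsilon> \<le> 1" "x \<in> dilate (1 - \<epsilon>) {x. \<mu> x \<le> 1}"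
    then obtain y where y: "x = (1 - \<epsilon>) *\<^sub>R y" "\<mu> y \<le> 1" by (auto simp: dilate_def)
    define z where "z = t *\<^sub>R x"
    have "\<mu> z = t * ((1 - \<epsilon>) * \<mu> y)"
      using hom[of t x] hom[of "1 - \<epsilon>" y] y t \<open>\<epsilon> \<le> 1\<close> by (simp add: z_def)
    also have "\<dots> \<le> t * (1 - \<epsilon>)"
      using y \<open>\<epsilon> \<le> 1\<close> t by (intro mult_left_mono) (auto intro: mult_left_le)
    finally have "(1 + \<kappa>) * \<mu> z \<le> (1 + \<epsilon> / 2) * (t * (1 - \<epsilon>))"
      using \<kappa> \<mu>0 by (intro mult_mono) auto
    also have "\<dots> = t * (1 - \<epsilon> / 2 - \<epsilon>\<^sup>2 / 2)" by (simp add: field_simps power2_eq_square)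
    also have "\<dots> \<le> t * (1 - \<epsilon> / 2)" using t by (intro mult_left_mono) auto
    finally have "T z \<le> t"
      using approx[of z] t by (simp add: algebra_simps)
    then show "x \<in> dilate (1 / t) {x. T x \<le> t}" using t by (simp add: mem_dilate_iff z_def)
  next
    fix x assume "x \<in> dilate (1 / t) {x. T x \<le> t}"
    then have "T (t *\<^sub>R x) \<le> t" using t by (simp add: mem_dilate_iff)
    then have "(1 - \<kappa>) * \<mu> (t *\<^sub>R x) \<le> t + \<epsilon> / 2 * t"
      using approx[of "t *\<^sub>R x"] t by (simp add: algebra_simps)
    also have "\<dots> = t * ((1 - \<kappa>) * (1 + \<epsilon>))" unfolding \<kappa>(3) by (simp add: algebra_simps)
    also have "\<dots> = (1 - \<kappa>) * (t * (1 + \<epsilon>))" by (rule mult.left_commute)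
    finally have "\<mu> (t *\<^sub>R x) \<le> t * (1 + \<epsilon>)"
      using \<kappa>1 by (simp only: mult_le_cancel_left_pos)
    then have "t * \<mu> x \<le> t * (1 + \<epsilon>)" using t hom[of t x] by simp
    then have "\<mu> x \<le> 1 + \<epsilon>" using t by simp
    then show "x \<in> dilate (1 + \<epsilon>) {x. \<mu> x \<le> 1}"
      using \<epsilon> by (simp add: mem_dilate_iff hom field_simps)
  qed
qed

text \<open>The constant \<open>a\<close> is the minimum of \<open>p\<close> on the Euclidean unit
  sphere, attained by compactness and positive by definiteness. It bounds the unit ball of
  \<open>p\<close>, while the Lipschitz constant puts a Euclidean ball of radius
  \<open>1 / C\<close> inside it.\<close>

lemma is_norm_unit_ball:
  fixes p :: "'a::euclidean_space \<Rightarrow> real"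
  assumes p: "is_norm p" and C: "0 < C" and lip: "\<And>x y. \<bar>p x - p y\<bar> \<le> C * dist x y"
  obtains a where "0 < a" "\<And>x. a * norm x \<le> p x"
    and "convex {x. p x \<le> 1}" "compact {x. p x \<le> 1}" "interior {x. p x \<le> 1} \<noteq> {}"
proof -
  note p = p[unfolded is_norm_def]
  have "C-lipschitz_on UNIV p"
    using C lip by (intro lipschitz_onI) (auto simp: dist_real_def)
  then have cont: "continuous_on S p" for S
    using lipschitz_on_continuous_on continuous_on_subset by blast
  obtain s where s: "s \<in> sphere (0::'a) 1" "\<And>x. x \<in> sphere 0 1 \<Longrightarrow> p s \<le> p x"
    using continuous_attains_inf[OF compact_sphere _ cont, of "0::'a" 1] by auto
  have a: "p s * norm x \<le> p x" for x
  proof (cases "x = 0")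
    case False
    then have "p s \<le> p (x /\<^sub>R norm x)" by (intro s(2)) simp
    also have "\<dots> = p x / norm x" using p by (simp add: divide_inverse mult.commute)
    finally show ?thesis using False by (simp add: field_simps)
  qed (use p in simp)
  have "p s \<noteq> 0" using p s(1) by auto
  then have "0 < p s" using p by (simp add: order_less_le)
  moreover note a
  moreover have "convex {x. p x \<le> 1}"
    unfolding convex_alt
  proof (clarsimp)
    fix x y and u :: real assume *: "p x \<le> 1" "p y \<le> 1" "0 \<le> u" "u \<le> 1"
    have "p ((1 - u) *\<^sub>R x + u *\<^sub>R y) \<le> (1 - u) * p x + u * p y"
      using p * by (metis abs_of_nonneg diff_ge_0_iff_ge)
    also have "\<dots> \<le> 1" by (rule convex_bound_le) (use * in auto)
    finally show "p ((1 - u) *\<^sub>R x + u *\<^sub>R y) \<le> 1" .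
  qed
  moreover have "compact {x. p x \<le> 1}"
    unfolding compact_eq_bounded_closed
  proof
    have "norm x \<le> 1 / p s" if "p x \<le> 1" for x
      using a[of x] that \<open>0 < p s\<close> by (simp add: field_simps)
    then show "bounded {x. p x \<le> 1}" by (auto simp: bounded_iff)
    show "closed {x. p x \<le> 1}" by (intro closed_Collect_le cont continuous_on_const)
  qed
  moreover have "interior {x. p x \<le> 1} \<noteq> {}"
  proof -
    have "ball 0 (1 / C) \<subseteq> {x. p x \<le> 1}"
    proof
      fix x :: 'a assume "x \<in> ball 0 (1 / C)"
      then have "C * norm x \<le> 1" using C by (simp add: field_simps)
      moreover have "p 0 = 0" using p by blast
      ultimately show "x \<in> {x. p x \<le> 1}" using lip[of x 0] by simp
    qed
    then show ?thesis using C by (metis centre_in_ball empty_iff mem_interior zero_less_divide_1_iff)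
  qed
  ultimately show ?thesis by (rule that)
qed

section \<open>The shape theorem\<close>

theorem corollary2p13:
  fixes M :: "'w measure"
    and N :: "(real ^ 'n \<Rightarrow> real) measure"
    and \<sigma> :: "'w \<Rightarrow> real ^ 'n \<Rightarrow> real"
    and \<mu> :: "real ^ 'n \<Rightarrow> real"
    and K :: "(real ^ 'n) set"
  assumes density: "random_density M N \<sigma>"
    and meas: "AE \<omega> in M. \<sigma> \<omega> \<in> borel_measurable borel"
    and moment: "\<And>x. (\<integral>\<^sup>+ \<omega>. path_integral (\<sigma> \<omega>) (linepath 0 x) \<partial>M) < \<infinity>"
    and ergodic: "\<And>v. v \<noteq> 0 \<Longrightarrow> ergodic_for (distr M N \<sigma>) (translate v)"
    and lipschitz: "\<exists>C>0. AE \<omega> in M. \<forall>x y. pseudometric (\<sigma> \<omega>) x y \<le> ennreal (C * dist x y)"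
  defines "\<mu> \<equiv> time_constant M \<sigma>"
    and "K \<equiv> {x. \<mu> x \<le> 1}"
  shows "((\<forall>v. \<mu> v = 0) \<longrightarrow>
           (\<forall>r>0. AE \<omega> in M. eventually
              (\<lambda>t. dilate r (cball 0 1) \<subseteq> dilate (1 / t) (growing_ball (\<sigma> \<omega>) t)) at_top))
       \<and> (is_norm \<mu> \<longrightarrow>
           convex K \<and> compact K \<and> interior K \<noteq> {}
         \<and> (\<forall>\<epsilon>>0. AE \<omega> in M. eventually
              (\<lambda>t. (\<epsilon> \<le> 1 \<longrightarrow> dilate (1 - \<epsilon>) K \<subseteq> dilate (1 / t) (growing_ball (\<sigma> \<omega>) t))
                 \<and> dilate (1 / t) (growing_ball (\<sigma> \<omega>) t) \<subseteq> dilate (1 + \<epsilon>) K) at_top)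
         \<and> ((\<forall>R. orthogonal_transformation R \<longrightarrow> law_invariant (distr M N \<sigma>) (\<lambda>f. f \<circ> R)) \<longrightarrow>
              (\<exists>c>0. (\<forall>u. norm u = 1 \<longrightarrow> \<mu> u = c) \<and> K = dilate (1 / c) (cball 0 1))))"
proof -
  obtain C where C: "0 < C"
    and lip: "AE \<omega> in M. \<forall>x y. pseudometric (\<sigma> \<omega>) x y \<le> ennreal (C * dist x y)"
    using lipschitz by blast
  interpret ergodic_lipschitz_density M N \<sigma> C
    by unfold_locales (use density meas ergodic C lip in auto)
  \<comment> \<open>The restriction to \<open>t \<ge> 0\<close> matters: \<open>ennreal\<close>
    sends negative numbers to 0, so \<open>growing_ball\<close> at a negative time still contains
    the origin.\<close>
  have ball: "AE \<omega> in M. \<forall>t\<ge>0. growing_ball (\<sigma> \<omega>) t = {x. T \<omega> x \<le> t}"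
    using AE_regular by eventually_elim (auto simp: growing_ball_def)
  have ball_eq: "eventually (\<lambda>t. growing_ball (\<sigma> \<omega>) t = {x. T \<omega> x \<le> t}) at_top"
    if "\<forall>t\<ge>0. growing_ball (\<sigma> \<omega>) t = {x. T \<omega> x \<le> t}" for \<omega>
    using eventually_ge_at_top[of "0::real"] by eventually_elim (use that in auto)
  have zero: "AE \<omega> in M. eventually
      (\<lambda>t. dilate r (cball 0 1) \<subseteq> dilate (1 / t) (growing_ball (\<sigma> \<omega>) t)) at_top"
    if \<mu>: "\<forall>v. \<mu> v = 0" and r: "0 < r" for r
  proof -
    have "AE \<omega> in M. \<exists>A. \<forall>x. \<bar>T \<omega> x - time_constant M \<sigma> x\<bar> \<le> A + 1 / (2 * r) * norm x"
      by (rule AE_sublinear_approximation) (use \<mu> r in \<open>auto simp: \<mu>_def\<close>)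
    then show ?thesis
      using ball
    proof eventually_elim
      case (elim \<omega>)
      then obtain A where "\<And>x. \<bar>T \<omega> x\<bar> \<le> A + 1 / (2 * r) * norm x"
        using \<mu> by (auto simp: \<mu>_def)
      from sublinear_ball_inclusion[of r "T \<omega>", OF r this] ball_eq[OF elim(2)]
      show ?case by eventually_elim simp
    qed
  qed
  have "convex K \<and> compact K \<and> interior K \<noteq> {}
      \<and> (\<forall>\<epsilon>>0. AE \<omega> in M. eventually
          (\<lambda>t. (\<epsilon> \<le> 1 \<longrightarrow> dilate (1 - \<epsilon>) K \<subseteq> dilate (1 / t) (growing_ball (\<sigma> \<omega>) t))
             \<and> dilate (1 / t) (growing_ball (\<sigma> \<omega>) t) \<subseteq> dilate (1 + \<epsilon>) K) at_top)
      \<and> ((\<forall>R. orthogonal_transformation R \<longrightarrow> law_invariant (distr M N \<sigma>) (\<lambda>f. f \<circ> R)) \<longrightarrow>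
          (\<exists>c>0. (\<forall>u. norm u = 1 \<longrightarrow> \<mu> u = c) \<and> K = dilate (1 / c) (cball 0 1)))"
    if norm: "is_norm \<mu>"
  proof -
    have hom: "\<mu> (a *\<^sub>R x) = a * \<mu> x" if "0 \<le> a" for a x
      using norm that by (simp add: is_norm_def)
    obtain a where a: "0 < a" "\<And>x. a * norm x \<le> \<mu> x"
      and K: "convex K" "compact K" "interior K \<noteq> {}"
      using is_norm_unit_ball[OF norm C] time_constant_lipschitz unfolding \<mu>_def K_def by blast
    have shape: "AE \<omega> in M. eventually
        (\<lambda>t. (\<epsilon> \<le> 1 \<longrightarrow> dilate (1 - \<epsilon>) K \<subseteq> dilate (1 / t) (growing_ball (\<sigma> \<omega>) t))
           \<and> dilate (1 / t) (growing_ball (\<sigma> \<omega>) t) \<subseteq> dilate (1 + \<epsilon>) K) at_top"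
      if \<epsilon>: "0 < \<epsilon>" for \<epsilon>
    proof -
      have "AE \<omega> in M. \<exists>A. \<forall>x. \<bar>T \<omega> x - \<mu> x\<bar> \<le> A + (\<epsilon> / (2 * (1 + \<epsilon>)) * a) * norm x"
        unfolding \<mu>_def
        by (rule AE_sublinear_approximation) (use \<epsilon> a(1) hom in \<open>auto simp: \<mu>_def\<close>)
      then show ?thesis
        using ball
      proof eventually_elim
        case (elim \<omega>)
        then obtain A where "\<And>x. \<bar>T \<omega> x - \<mu> x\<bar> \<le> A + (\<epsilon> / (2 * (1 + \<epsilon>)) * a) * norm x" by blast
        then have "eventually (\<lambda>t. (\<epsilon> \<le> 1 \<longrightarrow> dilate (1 - \<epsilon>) K \<subseteq> dilate (1 / t) {x. T \<omega> x \<le> t})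
            \<and> dilate (1 / t) {x. T \<omega> x \<le> t} \<subseteq> dilate (1 + \<epsilon>) K) at_top"
          unfolding K_def by (intro shape_inclusions[OF \<epsilon> hom a]) auto
        with ball_eq[OF elim(2)] show ?case by eventually_elim simp
      qed
    qed
    have isotropic: "\<exists>c>0. (\<forall>u. norm u = 1 \<longrightarrow> \<mu> u = c) \<and> K = dilate (1 / c) (cball 0 1)"
      if inv: "\<forall>R. orthogonal_transformation R \<longrightarrow> law_invariant (distr M N \<sigma>) (\<lambda>f. f \<circ> R)"
    proof -
      obtain e :: "real ^ 'n" where e: "norm e = 1" using vector_choose_size[of 1] by auto
      \<comment> \<open>The orthogonal group acts transitively on the unit sphere.\<close>
      have unit: "\<mu> u = \<mu> e" if u: "norm u = 1" for u
      proof -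
        obtain R where "orthogonal_transformation R" "R e = u"
          using orthogonal_transformation_exists[of e u] e u by auto
        then show ?thesis using time_constant_orthogonal[of R e] inv by (auto simp: \<mu>_def)
      qed
      have pos: "0 < \<mu> e" using a(1) a(2)[of e] e by simp
      have radial: "\<mu> x = norm x * \<mu> e" for x
      proof (cases "x = 0")
        case True
        then show ?thesis using norm by (simp add: is_norm_def)
      next
        case False
        then have "\<mu> (x /\<^sub>R norm x) = \<mu> e" by (intro unit) simp
        then show ?thesis using hom[of "norm x" "x /\<^sub>R norm x"] False by simp
      qed
      have "x \<in> K \<longleftrightarrow> x \<in> dilate (1 / \<mu> e) (cball 0 1)" for x
        using pos unfolding K_def mem_Collect_eq radial[of x] by (simp add: mem_dilate_iff mult.commute)
      then have "K = dilate (1 / \<mu> e) (cball 0 1)" by blast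
      then show ?thesis using pos unit by blast
    qed
    show ?thesis using K shape isotropic by blast
  qed
  then show ?thesis using zero by blast
qed

end
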